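(* Let $\alpha\in(\frac14,\frac12]$ and $N=\lfloor1/\alpha\rfloor$. Let $\mathbf X$ be an $\alpha$-Hölder planarly branched rough path over $A=\{1,\dots,d\}$ above $X=(X^1,\dots,X^d):[0,T]\to\mathbb R^d$, let $f=(f_1,\dots,f_d)$ with each $f_i:\mathbb R^n\to\mathbb R^n$ smooth, and let $\mathbf Y:[0,T]\to(\mathbb R\mathcal F^{\le N-1})^n$, with $\langle\mathbf 1,\mathbf Y_s\rangle=Y_s$, be the unique $\mathbf X$-controlled planarly branched rough path solving the rough differential equation $d\mathbf Y_t=f(\mathbf Y_t)\cdot dX_t$, $Y_0=\xi$. Then $$Y_t-Y_s=\sum_{\tau\in\mathcal T^{\le N}\setminus\{\mathbf 1\}}f_\tau(Y_s)\,\langle\mathbf X_{s,t},\tau\rangle+o(|t-s|),$$ where the sum runs over all nonempty $A$-decorated planar rooted trees $\tau$ with at most $N$ vertices, and $f_\tau:\mathbb R^n\to\mathbb R^n$ is defined recursively by $f_{\bullet_i}:=f_i$ and $f_{[\tau_1\cdots\tau_m]_i}(u):=D^mf_i(u):(f_{\tau_1}(u),\dots,f_{\tau_m}(u))$ for trees $\tau_1,\dots,\tau_m$.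
   Context: Forests. $\mathcal F$ is the set of $A$-decorated planar rooted forests, i.e. finite ordered (possibly empty) sequences of planar rooted trees with vertices decorated by $A=\{1,\dots,d\}$; concatenation is written as juxtaposition, $\mathbf 1$ is the empty forest, $|\tau|$ is the number of vertices, and $\mathcal F^{\le m}=\{\tau\in\mathcal F:|\tau|\le m\}$. For $\tau\in\mathcal F$ and $i\in A$, $[\tau]_i$ is the tree obtained by joining the roots of the trees of $\tau$ (in the same left-to-right order) to a new root decorated by $i$; $\bullet_i=[\mathbf 1]_i$. $\mathcal T^{\le N}$ is the set of trees in $\mathcal F^{\le N}$. Munthe-Kaas–Wright (MKW) Hopf algebra: $\mathbb R\mathcal F$ with the shuffle product ⧢ (forests viewed as words whose letters are trees) and the coproduct $\Delta$ given recursively by $\Delta(\mathbf 1)=\mathbf 1\otimes\mathbf 1$ and $\Delta(\omega[\tau]_i)=\omega[\tau]_i\otimes\mathbf 1+\Delta(\omega)\cdot(\mathrm{id}\otimes[\,\cdot\,]_i)\Delta(\tau)$ for $\omega,\tau\in\mathcal F$, where $\cdot$ shuffles left tensor factors and concatenates right tensor factors (left admissible cuts). The pairing is $\langle\tau,\tau'\rangle=\delta_{\tau,\tau'}$ on forests and $\star$ is the dual product: $\langle x\star y,\tau\rangle=\langle x\otimes y,\Delta\tau\rangle$. Everything is truncated at $\mathbb R\mathcal F^{\le N}$. Planarly branched rough path. An $\alpha$-Hölder planarly branched rough path is a map $\mathbf X:[0,T]^2\to\mathbb R\mathcal F^{\le N}$ with $\langle\mathbf X_{s,t},\mathbf 1\rangle=1$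 such that (1) $\mathbf X_{s,u}\star\mathbf X_{u,t}=\mathbf X_{s,t}$ in the algebra truncated at $N$; (2) $\langle\mathbf X_{s,t},\sigma ⧢ \tau\rangle=\langle\mathbf X_{s,t},\sigma\rangle\langle\mathbf X_{s,t},\tau\rangle$ whenever $|\sigma|+|\tau|\le N$; (3) $\sup_{s\ne t}|\langle\mathbf X_{s,t},\tau\rangle|/|t-s|^{|\tau|\alpha}<\infty$ for all $\tau\in\mathcal F^{\le N}$. It is above $X$ if $\langle\mathbf X_{s,t},\bullet_i\rangle=X^i_t-X^i_s$ for all $i$. Controlled path. A map $\mathbf Y:[0,T]\to(\mathbb R\mathcal F^{\le N-1})^n$ (so $\langle\tau,\mathbf Y_t\rangle\in\mathbb R^n$) is an $\mathbf X$-controlled planarly branched rough path above $Y=\langle\mathbf 1,\mathbf Y\rangle$ if $|\langle\tau,\mathbf Y_t\rangle-\langle\mathbf X_{s,t}\star\tau,\mathbf Y_s\rangle|=O(|t-s|^{(N-|\tau|)\alpha})$ uniformly in $s,t$, for all $\tau\in\mathcal F^{\le N-1}$. Rough integral. For $\mathbf Y$ $\mathbf X$-controlled above $Y$ and $i\in A$, $\int_s^tY_r\,dX^i_r$ is the limit, as the mesh of partitions $\pi$ of $[s,t]$ tends to $0$, of $\sum_{[u,v]\in\pi}\sum_{\tau\in\mathcal F^{\le N-1}}\langle\tau,\mathbf Y_u\rangle\langle\mathbf X_{u,v},[\tau]_i\rangle$; for $\alpha\in(\frac14,\frac12]$ it is known that this limit exists and that $\big|\int_s^tY_r\,dX^i_r-\sum_{\tau\in\mathcal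 F^{\le N-1}}\langle\tau,\mathbf Y_s\rangle\langle\mathbf X_{s,t},[\tau]_i\rangle\big|=O(|t-s|^{(N+1)\alpha})$. Derivatives. For smooth $G:\mathbb R^n\to\mathbb R^n$, $D^mG(u):(v_1,\dots,v_m)=\sum_{a_1,\dots,a_m=1}^n\partial_{a_1}\cdots\partial_{a_m}G(u)\,v_1^{a_1}\cdots v_m^{a_m}$. Composition. For $\mathbf Y$ $\mathbf X$-controlled above $Y$ and smooth $G:\mathbb R^n\to\mathbb R^n$, $G(\mathbf Y)$ is the $\mathbf X$-controlled path with $\langle\mathbf 1,G(\mathbf Y)_t\rangle=G(Y_t)$ and $\langle\tau,G(\mathbf Y)_t\rangle=\sum_{m=1}^{N-1}\sum_{\tau_1\cdots\tau_m=\tau}D^mG(Y_t):(\langle\tau_1,\mathbf Y_t\rangle,\dots,\langle\tau_m,\mathbf Y_t\rangle)$ for $\tau\in\mathcal F^{\le N-1}\setminus\{\mathbf 1\}$, the inner sum over factorizations of $\tau$ into nonempty forests. Solution of the RDE. $\mathbf Y$, $\mathbf X$-controlled above $Y$, solves $d\mathbf Y=f(\mathbf Y)\cdot dX$, $Y_0=\xi$, if $Y_t=\xi+\sum_{i=1}^d\int_0^tf_i(Y_r)\,dX^i_r$ (rough integrals of the lifts $f_i(\mathbf Y)$), $\langle[\tau]_i,\mathbf Y_t\rangle=\langle\tau,f_i(\mathbf Y)_t\rangle$ for $i\in A$, $\tau\in\mathcal F^{\le N-2}$, and $\langle\tau,\mathbf Y_t\rangle=0$ for every nonempty $\tau\in\mathcal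 F^{\le N-1}$ that is not a tree. $o(|t-s|)$ means uniformly of smaller order than $|t-s|$ as $|t-s|\to0$. *)

theory Defs
  imports "HOL-Analysis.Analysis" "HOL-Library.Multiset"
begin

section \<open>Decorated planar forests\<close>

datatype 'd tree = Node 'd "'d tree list"

type_synonym 'd forest = "'d tree list"

text \<open>The constructor \<open>Node i \<tau>\<close> is $[\tau]_i$, the list \<open>[]\<close> is the empty forest
  $\mathbf 1$, and $\bullet_i$ is \<open>Node i []\<close>.\<close>

primrec tree_size :: "'d tree \<Rightarrow> nat" where
  "tree_size (Node i ts) = Suc (sum_list (map tree_size ts))"

definition forest_size :: "'d forest \<Rightarrow> nat" where
  "forest_size \<tau> = sum_list (map tree_size \<tau>)"

definition forests_le :: "nat \<Rightarrow> 'd forest set" where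
  "forests_le m = {\<tau>. forest_size \<tau> \<le> m}"

definition trees_le :: "nat \<Rightarrow> 'd tree set" where
  "trees_le m = {t. tree_size t \<le> m}"

text \<open>The sums over these index sets below are therefore genuine finite sums.\<close>

lemma tree_size_pos: "0 < tree_size t"
  by (cases t) simp

lemma forests_le_subset:
  "forests_le m \<subseteq> insert [] (\<Union>t\<in>trees_le m. (\<lambda>\<tau>. t # \<tau>) ` forests_le (m - 1))"
proof
  fix \<tau> :: "'d forest"
  assume a: "\<tau> \<in> forests_le m"
  show "\<tau> \<in> insert [] (\<Union>t\<in>trees_le m. (\<lambda>\<tau>. t # \<tau>) ` forests_le (m - 1))"
  proof (cases \<tau>)
    case (Cons t ts)
    with a tree_size_pos[of t] have "t \<in> trees_le m" and "ts \<in> forests_le (m - 1)"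
      by (auto simp: forests_le_def trees_le_def forest_size_def)
    with Cons show ?thesis by blast
  qed simp
qed

lemma trees_le_Suc_subset: "trees_le (Suc m) \<subseteq> (\<Union>i. Node i ` forests_le m)"
proof
  fix t :: "'d tree"
  assume "t \<in> trees_le (Suc m)"
  then show "t \<in> (\<Union>i. Node i ` forests_le m)"
    by (cases t) (auto simp: forests_le_def trees_le_def forest_size_def)
qed

lemma finite_forests_trees_le:
  "finite (forests_le m :: 'd::finite forest set) \<and> finite (trees_le m :: 'd tree set)"
proof (induction m)
  case 0
  have "trees_le 0 = ({} :: 'd tree set)"
    by (auto simp: trees_le_def tree_size_pos)
  then show ?case
    using forests_le_subset[of 0, where ?'a = 'd] finite_subset by fastforce
next
  case (Suc m)
  then have t: "finite (trees_le (Suc m) :: 'd tree set)"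
    by (intro finite_subset[OF trees_le_Suc_subset]) auto
  with Suc have "finite (forests_le (Suc m) :: 'd forest set)"
    by (intro finite_subset[OF forests_le_subset]) auto
  with t show ?case by simp
qed

section \<open>The Munthe-Kaas--Wright Hopf algebra\<close>

text \<open>All structure constants of the shuffle product and of the coproduct with respect to the
  basis of forests are natural numbers.  A multiset stands for the formal sum of its elements,
  counted with multiplicity; a pair \<open>(a, b)\<close> stands for $a \otimes b$.\<close>

fun shuffle :: "'a list \<Rightarrow> 'a list \<Rightarrow> 'a list multiset" where
  "shuffle [] w = {#w#}"
| "shuffle v [] = {#v#}"
| "shuffle (a # v) (b # w) =
     image_mset ((#) a) (shuffle v (b # w)) + image_mset ((#) b) (shuffle (a # v) w)"

text \<open>Shuffle of the left factors, concatenation of the right factors.\<close>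

definition tensor_mult ::
  "('a list \<times> 'a list) multiset \<Rightarrow> ('a list \<times> 'a list) multiset \<Rightarrow> ('a list \<times> 'a list) multiset"
where
  "tensor_mult P Q =
     (\<Sum>(a, b)\<in>#P. \<Sum>(c, d)\<in>#Q. image_mset (\<lambda>e. (e, b @ d)) (shuffle a c))"

function coproduct :: "'d forest \<Rightarrow> ('d forest \<times> 'd forest) multiset" where
  "coproduct [] = {#([], [])#}"
| "coproduct (\<omega> @ [Node i \<tau>]) =
     {#(\<omega> @ [Node i \<tau>], [])#} +
     tensor_mult (coproduct \<omega>) (image_mset (\<lambda>(a, b). (a, [Node i b])) (coproduct \<tau>))"
proof -
  fix P and \<tau> :: "'d forest"
  assume "\<tau> = [] \<Longrightarrow> P" and "\<And>\<omega> i \<tau>'. \<tau> = \<omega> @ [Node i \<tau>'] \<Longrightarrow> P"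
  then show P
    by (metis rev_exhaust tree.exhaust)
qed auto
termination
  by (relation "Wellfounded.measure forest_size") (auto simp: forest_size_def)

text \<open>An element $x$ of (the truncation of) $\mathbb R\mathcal F$, or of its $n$-fold power, is
  represented by its coefficient function $\tau \mapsto \langle x, \tau\rangle$.\<close>

definition truncated :: "nat \<Rightarrow> ('d forest \<Rightarrow> 'v::zero) set" where
  "truncated m = {x. \<forall>\<tau>. \<tau> \<notin> forests_le m \<longrightarrow> x \<tau> = 0}"

definition basis :: "'d forest \<Rightarrow> 'd forest \<Rightarrow> real" where
  "basis \<tau> = (\<lambda>\<sigma>. if \<sigma> = \<tau> then 1 else 0)"

definition star :: "('d forest \<Rightarrow> real) \<Rightarrow> ('d forest \<Rightarrow> real) \<Rightarrow> 'd forest \<Rightarrow> real"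
    (infixl "\<star>" 70) where
  "(x \<star> y) \<tau> = (\<Sum>(a, b)\<in>#coproduct \<tau>. x a * y b)"

section \<open>Rough paths and controlled paths\<close>

definition planarly_branched_rough_path ::
  "real \<Rightarrow> nat \<Rightarrow> real \<Rightarrow> (real \<Rightarrow> real \<Rightarrow> 'd forest \<Rightarrow> real) \<Rightarrow> bool" where
  "planarly_branched_rough_path \<alpha> N T \<X> \<longleftrightarrow>
     (\<forall>s\<in>{0..T}. \<forall>t\<in>{0..T}. \<X> s t \<in> truncated N \<and> \<X> s t [] = 1) \<and>
     (\<forall>s\<in>{0..T}. \<forall>u\<in>{0..T}. \<forall>t\<in>{0..T}. \<forall>\<tau>\<in>forests_le N.
        (\<X> s u \<star> \<X> u t) \<tau> = \<X> s t \<tau>) \<and>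
     (\<forall>s\<in>{0..T}. \<forall>t\<in>{0..T}. \<forall>\<sigma> \<tau>. forest_size \<sigma> + forest_size \<tau> \<le> N \<longrightarrow>
        (\<Sum>\<rho>\<in>#shuffle \<sigma> \<tau>. \<X> s t \<rho>) = \<X> s t \<sigma> * \<X> s t \<tau>) \<and>
     (\<forall>\<tau>\<in>forests_le N.
        bdd_above {\<bar>\<X> s t \<tau>\<bar> / \<bar>t - s\<bar> powr (real (forest_size \<tau>) * \<alpha>) | s t.
          s \<in> {0..T} \<and> t \<in> {0..T} \<and> s \<noteq> t})"

definition rough_path_above ::
  "real \<Rightarrow> (real \<Rightarrow> real \<Rightarrow> 'd::finite forest \<Rightarrow> real) \<Rightarrow> (real \<Rightarrow> real ^ 'd) \<Rightarrow> bool" where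
  "rough_path_above T \<X> X \<longleftrightarrow>
     (\<forall>s\<in>{0..T}. \<forall>t\<in>{0..T}. \<forall>i. \<X> s t [Node i []] = X t $ i - X s $ i)"

definition controlled_path ::
  "real \<Rightarrow> nat \<Rightarrow> real \<Rightarrow> (real \<Rightarrow> real \<Rightarrow> 'd::finite forest \<Rightarrow> real) \<Rightarrow>
   (real \<Rightarrow> 'd forest \<Rightarrow> real ^ 'n) \<Rightarrow> bool" where
  "controlled_path \<alpha> N T \<X> \<Y> \<longleftrightarrow>
     (\<forall>t\<in>{0..T}. \<Y> t \<in> truncated (N - 1)) \<and>
     (\<forall>\<tau>\<in>forests_le (N - 1). \<exists>C. \<forall>s\<in>{0..T}. \<forall>t\<in>{0..T}.
        norm (\<Y> t \<tau> - (\<Sum>\<sigma>\<in>forests_le (N - 1). (\<X> s t \<star> basis \<tau>) \<sigma> *\<^sub>R \<Y> s \<sigma>))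
          \<le> C * \<bar>t - s\<bar> powr ((real N - real (forest_size \<tau>)) * \<alpha>))"

section \<open>The rough integral\<close>

text \<open>A partition $s = t_0 < \dots < t_k = t$ is given by the list of its points; its intervals
  are the pairs of consecutive points.  For $s = t$ it has no intervals.\<close>

definition is_partition :: "real \<Rightarrow> real \<Rightarrow> real list \<Rightarrow> bool" where
  "is_partition s t p \<longleftrightarrow> p \<noteq> [] \<and> hd p = s \<and> last p = t \<and> sorted_wrt (<) p"

definition intervals :: "real list \<Rightarrow> (real \<times> real) list" where
  "intervals p = zip p (tl p)"

definition mesh_filter :: "real \<Rightarrow> real \<Rightarrow> real list filter" where
  "mesh_filter s t =
     (INF \<delta>\<in>{0<..}. principal {p. is_partition s t p \<and> (\<forall>(u, v)\<in>set (intervals p). v - u < \<delta>)})"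

definition has_rough_integral ::
  "nat \<Rightarrow> (real \<Rightarrow> real \<Rightarrow> 'd::finite forest \<Rightarrow> real) \<Rightarrow> (real \<Rightarrow> 'd forest \<Rightarrow> real ^ 'n) \<Rightarrow>
   'd \<Rightarrow> real \<Rightarrow> real \<Rightarrow> real ^ 'n \<Rightarrow> bool" where
  "has_rough_integral N \<X> \<Y> i s t I \<longleftrightarrow>
     ((\<lambda>p. \<Sum>(u, v)\<leftarrow>intervals p. \<Sum>\<tau>\<in>forests_le (N - 1). \<X> u v [Node i \<tau>] *\<^sub>R \<Y> u \<tau>)
       \<longlongrightarrow> I) (mesh_filter s t)"

section \<open>Derivatives and composition\<close>

primrec C_k :: "nat \<Rightarrow> (real ^ 'n \<Rightarrow> real ^ 'm) \<Rightarrow> bool" where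
  "C_k 0 G \<longleftrightarrow> continuous_on UNIV G"
| "C_k (Suc k) G \<longleftrightarrow>
     G differentiable_on UNIV \<and> (\<forall>v. C_k k (\<lambda>u. frechet_derivative G (at u) v))"

definition smooth :: "(real ^ 'n \<Rightarrow> real ^ 'm) \<Rightarrow> bool" where
  "smooth G \<longleftrightarrow> (\<forall>k. C_k k G)"

definition partial :: "'n \<Rightarrow> (real ^ 'n \<Rightarrow> real ^ 'm) \<Rightarrow> real ^ 'n \<Rightarrow> real ^ 'm" where
  "partial a G = (\<lambda>u. frechet_derivative G (at u) (axis a 1))"

text \<open>\<open>D G u [v\<^sub>1, \<dots>, v\<^sub>m]\<close> is $D^mG(u):(v_1,\dots,v_m)$; the list \<open>as\<close> runs over the index
  tuples $(a_1,\dots,a_m)$.\<close>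

definition D ::
  "(real ^ 'n \<Rightarrow> real ^ 'm) \<Rightarrow> real ^ 'n \<Rightarrow> (real ^ 'n) list \<Rightarrow> real ^ 'm" where
  "D G u vs =
     (\<Sum>as | length as = length vs.
        (\<Prod>j<length vs. (vs ! j) $ (as ! j)) *\<^sub>R foldr partial as G u)"

definition compose_controlled ::
  "nat \<Rightarrow> (real ^ 'n \<Rightarrow> real ^ 'n) \<Rightarrow> (real \<Rightarrow> 'd forest \<Rightarrow> real ^ 'n) \<Rightarrow>
   real \<Rightarrow> 'd forest \<Rightarrow> real ^ 'n" where
  "compose_controlled N G \<Y> t \<tau> =
     (if \<tau> = [] then G (\<Y> t [])
      else if \<tau> \<in> forests_le (N - 1) then
        \<Sum>m = 1..N - 1. \<Sum>\<tau>s | length \<tau>s = m \<and> [] \<notin> set \<tau>s \<and> concat \<tau>s = \<tau>.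
          D G (\<Y> t []) (map (\<Y> t) \<tau>s)
      else 0)"

section \<open>Rough differential equations and elementary differentials\<close>

definition solves_rde ::
  "real \<Rightarrow> nat \<Rightarrow> real \<Rightarrow> (real \<Rightarrow> real \<Rightarrow> 'd::finite forest \<Rightarrow> real) \<Rightarrow>
   ('d \<Rightarrow> real ^ 'n \<Rightarrow> real ^ 'n) \<Rightarrow> real ^ 'n \<Rightarrow> (real \<Rightarrow> 'd forest \<Rightarrow> real ^ 'n) \<Rightarrow> bool" where
  "solves_rde \<alpha> N T \<X> f \<xi> \<Y> \<longleftrightarrow>
     controlled_path \<alpha> N T \<X> \<Y> \<and>
     (\<forall>t\<in>{0..T}. \<exists>I.
        (\<forall>i. has_rough_integral N \<X> (compose_controlled N (f i) \<Y>) i 0 t (I i)) \<and>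
        \<Y> t [] = \<xi> + (\<Sum>i\<in>UNIV. I i)) \<and>
     (\<forall>t\<in>{0..T}. \<forall>i. \<forall>\<tau>\<in>forests_le (N - 2).
        \<Y> t [Node i \<tau>] = compose_controlled N (f i) \<Y> t \<tau>) \<and>
     (\<forall>t\<in>{0..T}. \<forall>\<tau>\<in>forests_le (N - 1). 2 \<le> length \<tau> \<longrightarrow> \<Y> t \<tau> = 0)"

fun elem_diff :: "('d \<Rightarrow> real ^ 'n \<Rightarrow> real ^ 'n) \<Rightarrow> 'd tree \<Rightarrow> real ^ 'n \<Rightarrow> real ^ 'n" where
  "elem_diff f (Node i []) u = f i u"
| "elem_diff f (Node i (t # ts)) u = D (f i) u (map (\<lambda>t'. elem_diff f t' u) (t # ts))"

end

theory Submission
  imports Defs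
begin

text \<open>Fix \<open>i\<close>, let \<open>Z = f\<^sub>i(\<Y>)\<close> and let \<open>A s t\<close> be the compensated summand
  \<open>\<Sum>\<tau>. \<langle>\<tau>, Z\<^sub>s\<rangle> \<langle>\<X>\<^sub>s\<^sub>t, [\<tau>]\<^sub>i\<rangle>\<close>.  Since \<open>\<Delta>[\<tau>]\<^sub>i = [\<tau>]\<^sub>i \<otimes> 1 + (id \<otimes> [\<cdot>]\<^sub>i) \<Delta>\<tau>\<close>, Chen's relation shows
  that the defect \<open>A s t - A s u - A u t\<close> pairs the remainders of the controlled path \<open>Z\<close> with
  \<open>\<X>\<^sub>u\<^sub>t\<close>, so it is of order \<open>(N + 1)\<alpha> > 1\<close>, and bisection bounds the difference between \<open>A s t\<close> and
  the rough integral by the same order.  For \<open>t < s\<close> the defect is applied to the triple \<open>(s, t, s)\<close>.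
  The rest is algebra: \<open>\<Y>\<close> vanishes on forests that are not trees, so by induction on the tree
  \<open>\<langle>\<tau>, Z\<^sub>s\<rangle>\<close> is the elementary differential of \<open>[\<tau>]\<^sub>i\<close> at \<open>Y\<^sub>s\<close>.

  That \<open>Z\<close> is controlled follows from Taylor's formula.  As \<open>N \<le> 3\<close>, only forests with at most two
  vertices occur; the second-order term matches because
  \<open>\<langle>\<X>, \<bullet>\<^sub>a\<rangle> \<langle>\<X>, \<bullet>\<^sub>b\<rangle> = \<langle>\<X>, \<bullet>\<^sub>a\<bullet>\<^sub>b\<rangle> + \<langle>\<X>, \<bullet>\<^sub>b\<bullet>\<^sub>a\<rangle>\<close> and the second derivative is symmetric.\<close>

section \<open>Taylor expansions of smooth maps\<close>

lemma smooth_differentiable: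
  assumes "smooth G"
  shows "G differentiable (at u)"
proof -
  have "C_k (Suc 0) G" using assms unfolding smooth_def by blast
  then show ?thesis by (simp add: differentiable_on_def)
qed

lemma smooth_partial:
  assumes "smooth G"
  shows "smooth (partial a G)"
  unfolding smooth_def
proof
  fix k
  have "C_k (Suc k) G" using assms unfolding smooth_def by blast
  then show "C_k k (partial a G)" by (simp add: partial_def)
qed

lemma smooth_has_derivative:
  fixes G :: "real ^ 'n \<Rightarrow> real ^ 'm"
  assumes "smooth G"
  shows "(G has_derivative (\<lambda>h. \<Sum>a\<in>UNIV. h $ a *\<^sub>R partial a G u)) (at u)"
proof -
  let ?F = "frechet_derivative G (at u)"
  have F: "(G has_derivative ?F) (at u)"
    using smooth_differentiable[OF assms] frechet_derivative_works by blast
  have "?F h = (\<Sum>a\<in>UNIV. h $ a *\<^sub>R partial a G u)" for h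
  proof -
    have "?F h = ?F (\<Sum>a\<in>UNIV. h $ a *\<^sub>R axis a 1)"
      using basis_expansion[of h] by (simp add: scalar_mult_eq_scaleR)
    also have "\<dots> = (\<Sum>a\<in>UNIV. h $ a *\<^sub>R partial a G u)"
      using has_derivative_linear[OF F] by (simp add: linear_sum linear_scale partial_def)
    finally show ?thesis .
  qed
  then have "?F = (\<lambda>h. \<Sum>a\<in>UNIV. h $ a *\<^sub>R partial a G u)" by blast
  with F show ?thesis by simp
qed

lemma smooth_continuous_on: "smooth G \<Longrightarrow> continuous_on S G"
  by (meson continuous_at_imp_continuous_on differentiable_imp_continuous_within
      smooth_differentiable)

section \<open>The iterated derivative \<open>D\<close> as a multilinear map\<close>

lemma D_Nil [simp]: "D G u [] = G u"
  by (simp add: D_def)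

text \<open>The last entry of an index list is the partial derivative taken first:
  \<open>foldr partial (as @ [a]) G\<close> is \<open>foldr partial as (partial a G)\<close>.
  Splitting it off leaves the same expression for \<open>partial a G\<close>. This recursion carries
  all inductions on the arguments of \<open>D\<close>, and \<open>G\<close> has to vary in
  them.\<close>

lemma D_snoc:
  fixes G :: "real ^ 'n \<Rightarrow> real ^ 'm"
  shows "D G u (vs @ [v]) = (\<Sum>a\<in>UNIV. v $ a *\<^sub>R D (partial a G) u vs)"
proof -
  let ?L = "{as :: 'n list. length as = length vs}"
  let ?t = "\<lambda>as. (\<Prod>j<length vs. (vs ! j) $ (as ! j))"
  have bij: "bij_betw (\<lambda>(a, as). as @ [a]) (UNIV \<times> ?L) {as. length as = length (vs @ [v])}"
    by (rule bij_betw_byWitness[where f' = "\<lambda>as. (last as, butlast as)"])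
       (auto simp: length_Suc_conv_rev)
  have "D G u (vs @ [v]) =
      (\<Sum>(a, as)\<in>UNIV \<times> ?L. (?t as * v $ a) *\<^sub>R foldr partial (as @ [a]) G u)"
    unfolding D_def
    by (subst sum.reindex_bij_betw[OF bij, symmetric])
       (auto intro!: sum.cong prod.cong simp: nth_append case_prod_beta)
  also have "\<dots> = (\<Sum>a\<in>UNIV. v $ a *\<^sub>R D (partial a G) u vs)"
    unfolding sum.cartesian_product[symmetric] D_def
    by (auto intro!: sum.cong simp: scaleR_right.sum mult.commute)
  finally show ?thesis .
qed

lemma D_single: "D G u [v] = (\<Sum>a\<in>UNIV. v $ a *\<^sub>R partial a G u)"
  using D_snoc[of G u "[]" v] by simp

lemma D_pair: "D G u [v, w] = (\<Sum>a\<in>UNIV. w $ a *\<^sub>R D (partial a G) u [v])"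
  using D_snoc[of G u "[v]" w] by simp

text \<open>Differentiation puts the new direction in front of \<open>vs\<close>, whereas the
  induction removes arguments at the end. The two do not interfere, so the sum from
  \<open>D_snoc\<close> can be differentiated term by term.\<close>

lemma D_has_derivative:
  assumes "smooth G"
  shows "((\<lambda>u. D G u vs) has_derivative (\<lambda>h. D G u (h # vs))) (at u)"
  using assms
proof (induction vs arbitrary: G rule: rev_induct)
  case Nil
  then show ?case using smooth_has_derivative by (simp add: D_single)
next
  case (snoc v vs)
  have "((\<lambda>u. \<Sum>a\<in>UNIV. v $ a *\<^sub>R D (partial a G) u vs) has_derivative
      (\<lambda>h. \<Sum>a\<in>UNIV. v $ a *\<^sub>R D (partial a G) u (h # vs))) (at u)"
    by (intro has_derivative_sum has_derivative_scaleR_right snoc.IH smooth_partial snoc.prems)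
  then show ?case
    using D_snoc[of G _ "_ # vs" v] by (simp add: D_snoc)
qed

text \<open>For \<open>k = 0\<close> this is continuity on a compact set. Each coordinate of a
  further argument \<open>w\<close> is at most \<open>norm w\<close>, so the constants of the
  partial derivatives simply add up.\<close>

lemma D_bounded:
  fixes G :: "real ^ 'n \<Rightarrow> real ^ 'm"
  assumes "smooth G" "compact K"
  obtains B where "0 \<le> B" and
    "\<And>u vs. u \<in> K \<Longrightarrow> length vs = k \<Longrightarrow> norm (D G u vs) \<le> B * prod_list (map norm vs)"
proof -
  have "\<exists>B\<ge>0. \<forall>u\<in>K. \<forall>vs. length vs = k \<longrightarrow> norm (D G u vs) \<le> B * prod_list (map norm vs)"
    using assms(1)
  proof (induction k arbitrary: G)
    case 0
    have "bounded (G ` K)"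
      using 0 assms(2) by (intro compact_imp_bounded compact_continuous_image smooth_continuous_on)
    then obtain B where "0 < B" "\<forall>x\<in>K. norm (G x) \<le> B"
      unfolding bounded_pos by auto
    then show ?case by (intro exI[of _ B]) auto
  next
    case (Suc k)
    have "\<forall>a. \<exists>B\<ge>0. \<forall>u\<in>K. \<forall>vs. length vs = k \<longrightarrow>
        norm (D (partial a G) u vs) \<le> B * prod_list (map norm vs)"
      using Suc.IH smooth_partial[OF Suc.prems] by blast
    then obtain B where B: "\<And>a. 0 \<le> B a" "\<And>a u vs. u \<in> K \<Longrightarrow> length vs = k \<Longrightarrow>
        norm (D (partial a G) u vs) \<le> B a * prod_list (map norm vs)"
      by metis
    have "norm (D G u vs) \<le> (\<Sum>a\<in>UNIV. B a) * prod_list (map norm vs)"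
      if u: "u \<in> K" and l: "length vs = Suc k" for u vs
    proof -
      obtain ws w where vs: "vs = ws @ [w]" "length ws = k"
        using l by (auto simp: length_Suc_conv_rev)
      have "norm (D G u vs) \<le> (\<Sum>a\<in>UNIV. norm (w $ a *\<^sub>R D (partial a G) u ws))"
        by (simp only: vs D_snoc norm_sum)
      also have "\<dots> \<le> (\<Sum>a\<in>UNIV. norm w * (B a * prod_list (map norm ws)))"
        using component_le_norm_cart[of w]
        by (intro sum_mono) (auto intro!: mult_mono B u vs(2))
      also have "\<dots> = (\<Sum>a\<in>UNIV. B a) * prod_list (map norm vs)"
        by (simp add: vs sum_distrib_left sum_distrib_right mult_ac)
      finally show ?thesis .
    qed
    then show ?case using B(1) by (intro exI[of _ "\<Sum>a\<in>UNIV. B a"]) (auto intro: sum_nonneg)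
  qed
  then show ?thesis using that by blast
qed

section \<open>Taylor remainders with constants uniform on balls\<close>

lemma smooth_Taylor:
  fixes G :: "real ^ 'n \<Rightarrow> real ^ 'm"
  assumes "smooth G"
  obtains C where "0 \<le> C" and
    "\<And>x y. x \<in> cball 0 R \<Longrightarrow> y \<in> cball 0 R \<Longrightarrow>
      norm (G y - (\<Sum>m\<le>k. (1 / fact m) *\<^sub>R D G x (replicate m (y - x))))
        \<le> C * norm (y - x) ^ Suc k"
proof -
  obtain B where B: "0 \<le> B" "\<And>u vs. u \<in> cball 0 R \<Longrightarrow> length vs = Suc k \<Longrightarrow>
      norm (D G u vs) \<le> B * prod_list (map norm vs)"
    by (rule D_bounded[OF assms compact_cball]) blast
  have "norm (G y - (\<Sum>m\<le>k. (1 / fact m) *\<^sub>R D G x (replicate m (y - x))))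
      \<le> real CARD('m) * B * norm (y - x) ^ Suc k"
    if x: "x \<in> cball 0 R" and y: "y \<in> cball 0 R" for x y
  proof -
    define h where "h = y - x"
    \<comment> \<open>\<open>g m\<close> is the m-th derivative of \<open>G\<close> along the
      segment from \<open>x\<close> to \<open>y\<close>. This reduces the claim to Taylor's formula
      in one real variable, coordinate by coordinate.\<close>
    define g where "g = (\<lambda>m r. D G (x + r *\<^sub>R h) (replicate m h))"
    let ?e = "G y - (\<Sum>m\<le>k. (1 / fact m) *\<^sub>R D G x (replicate m h))"
    have g': "((\<lambda>r. g m r $ j) has_field_derivative g (Suc m) r $ j) (at r within {0..1})" for m r j
    proof -
      have "((\<lambda>r. x + r *\<^sub>R h) has_vector_derivative h) (at r within {0..1})"
        by (auto intro!: derivative_eq_intros)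
      from vector_derivative_diff_chain_within[OF this
          has_derivative_at_withinI[OF D_has_derivative[OF assms]], of "replicate m h"]
      have "(g m has_vector_derivative g (Suc m) r) (at r within {0..1})"
        by (simp add: g_def o_def)
      from bounded_linear.has_vector_derivative[OF bounded_linear_vec_nth this]
      show ?thesis by (simp add: has_real_derivative_iff_has_vector_derivative)
    qed
    have bd: "norm (g (Suc k) r $ j) \<le> B * norm h ^ Suc k" if "r \<in> {0..1}" for r j
    proof -
      have "x + r *\<^sub>R h = (1 - r) *\<^sub>R x + r *\<^sub>R y" by (simp add: h_def algebra_simps)
      moreover have "\<dots> \<in> cball 0 R"
        using that x y convexD_alt[OF convex_cball, of x 0 R y r] by simp
      ultimately have "norm (g (Suc k) r) \<le> B * prod_list (map norm (replicate (Suc k) h))"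
        unfolding g_def by (intro B(2)) auto
      then show ?thesis
        using component_le_norm_cart[of "g (Suc k) r" j] by (simp add: prod_list_replicate)
    qed
    have "\<bar>?e $ j\<bar> \<le> B * norm h ^ Suc k" for j
    proof -
      have "norm (g 0 1 $ j - (\<Sum>i\<le>k. g i 0 $ j * (1 - 0) ^ i / fact i))
          \<le> B * norm h ^ Suc k * norm (1 - 0 :: real) ^ Suc k / fact k"
        using field_Taylor[of "{0..1}" k "\<lambda>m r. g m r $ j" "B * norm h ^ Suc k" 0 1] g' bd
        by simp
      \<comment> \<open>The one-dimensional formula divides the remainder by \<open>fact k\<close>;
        this gain is dropped, as only the order in \<open>norm h\<close> matters.\<close>
      moreover have "B * norm h ^ Suc k * norm (1 - 0 :: real) ^ Suc k / fact k \<le> B * norm h ^ Suc k"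
        using B(1) mult_left_mono[OF fact_ge_1[of k], of "B * norm h ^ Suc k"]
        by (simp add: divide_le_eq)
      ultimately show ?thesis
        by (simp add: g_def h_def)
    qed
    \<comment> \<open>Summing over the coordinates produces the factor \<open>CARD('m)\<close> of
      the constant.\<close>
    then have "norm ?e \<le> (\<Sum>j\<in>(UNIV :: 'm set). B * norm h ^ Suc k)"
      by (intro order_trans[OF norm_le_l1_cart] sum_mono)
    then show ?thesis by (simp add: h_def mult.assoc)
  qed
  with B(1) show ?thesis by (intro that[of "real CARD('m) * B"]) auto
qed

text \<open>With \<open>vs\<close> frozen, \<open>D G y vs\<close> is a linear combination of
  iterated partial derivatives of \<open>G\<close> at \<open>y\<close>. Induction on the number of
  frozen arguments reduces the claim to \<open>smooth_Taylor\<close>.\<close>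

lemma D_Taylor:
  fixes G :: "real ^ 'n \<Rightarrow> real ^ 'm"
  assumes "smooth G"
  obtains C where "0 \<le> C" and
    "\<And>x y vs. x \<in> cball 0 R \<Longrightarrow> y \<in> cball 0 R \<Longrightarrow> length vs = l \<Longrightarrow>
      norm (D G y vs - (\<Sum>m\<le>k. (1 / fact m) *\<^sub>R D G x (replicate m (y - x) @ vs)))
        \<le> C * norm (y - x) ^ Suc k * prod_list (map norm vs)"
proof -
  let ?e = "\<lambda>G x y vs. D G y vs - (\<Sum>m\<le>k. (1 / fact m) *\<^sub>R D G x (replicate m (y - x) @ vs))"
  have "\<exists>C\<ge>0. \<forall>x\<in>cball 0 R. \<forall>y\<in>cball 0 R. \<forall>vs. length vs = l \<longrightarrow>
      norm (?e G x y vs) \<le> C * norm (y - x) ^ Suc k * prod_list (map norm vs)"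
    using assms
  proof (induction l arbitrary: G)
    case 0
    obtain C where "0 \<le> C" and "\<And>x y. x \<in> cball 0 R \<Longrightarrow> y \<in> cball 0 R \<Longrightarrow>
        norm (G y - (\<Sum>m\<le>k. (1 / fact m) *\<^sub>R D G x (replicate m (y - x))))
          \<le> C * norm (y - x) ^ Suc k"
      by (rule smooth_Taylor[OF 0]) blast
    then show ?case by (intro exI[of _ C]) auto
  next
    case (Suc l)
    have "\<forall>a. \<exists>C. 0 \<le> C \<and> (\<forall>x\<in>cball 0 R. \<forall>y\<in>cball 0 R. \<forall>vs. length vs = l \<longrightarrow>
        norm (?e (partial a G) x y vs) \<le> C * norm (y - x) ^ Suc k * prod_list (map norm vs))"
      by (intro allI Suc.IH smooth_partial[OF Suc.prems])
    from choice[OF this] obtain C where "\<forall>a. 0 \<le> C a \<and>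
        (\<forall>x\<in>cball 0 R. \<forall>y\<in>cball 0 R. \<forall>vs. length vs = l \<longrightarrow>
        norm (?e (partial a G) x y vs) \<le> C a * norm (y - x) ^ Suc k * prod_list (map norm vs))" ..
    then have C: "\<And>a. 0 \<le> C a" "\<And>a x y vs. x \<in> cball 0 R \<Longrightarrow> y \<in> cball 0 R \<Longrightarrow>
        length vs = l \<Longrightarrow>
        norm (?e (partial a G) x y vs) \<le> C a * norm (y - x) ^ Suc k * prod_list (map norm vs)"
      by simp_all
    have "norm (?e G x y vs) \<le> (\<Sum>a\<in>UNIV. C a) * norm (y - x) ^ Suc k * prod_list (map norm vs)"
      if x: "x \<in> cball 0 R" and y: "y \<in> cball 0 R" and l: "length vs = Suc l" for x y vs
    proof -
      obtain ws w where vs: "vs = ws @ [w]" "length ws = l"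
        using l by (auto simp: length_Suc_conv_rev)
      have snoc: "D G x (replicate m (y - x) @ vs) =
          (\<Sum>a\<in>UNIV. w $ a *\<^sub>R D (partial a G) x (replicate m (y - x) @ ws))" for m
        using D_snoc[of G x "replicate m (y - x) @ ws" w] by (simp add: vs)
      have "(\<Sum>m\<le>k. (1 / fact m) *\<^sub>R D G x (replicate m (y - x) @ vs)) =
          (\<Sum>a\<in>UNIV. w $ a *\<^sub>R
            (\<Sum>m\<le>k. (1 / fact m) *\<^sub>R D (partial a G) x (replicate m (y - x) @ ws)))"
        unfolding snoc scaleR_right.sum
        by (subst sum.swap) (simp only: scaleR_left_commute)
      then have "?e G x y vs = (\<Sum>a\<in>UNIV. w $ a *\<^sub>R ?e (partial a G) x y ws)"
        by (simp only: vs D_snoc scaleR_right_diff_distrib sum_subtractf)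
      also have "norm \<dots> \<le> (\<Sum>a\<in>UNIV. norm (w $ a *\<^sub>R ?e (partial a G) x y ws))"
        by (rule norm_sum)
      also have "\<dots> \<le> (\<Sum>a\<in>UNIV. norm w * (C a * norm (y - x) ^ Suc k * prod_list (map norm ws)))"
        unfolding norm_scaleR
        using component_le_norm_cart[of w]
        by (intro sum_mono mult_mono C x y vs(2)) auto
      also have "\<dots> = (\<Sum>a\<in>UNIV. C a) * norm (y - x) ^ Suc k * prod_list (map norm vs)"
        by (simp add: vs sum_distrib_left sum_distrib_right mult_ac)
      finally show ?thesis .
    qed
    then show ?case using C(1) by (intro exI[of _ "\<Sum>a\<in>UNIV. C a"]) (auto intro: sum_nonneg)
  qed
  then show ?thesis using that by blast
qed

lemma D_map_scaleR: "D G u (map ((*\<^sub>R) r) vs) = r ^ length vs *\<^sub>R D G u vs"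
proof (induction vs arbitrary: G rule: rev_induct)
  case (snoc v vs)
  then show ?case by (simp add: D_snoc scaleR_right.sum mult.commute mult.left_commute)
qed simp

text \<open>The symmetry of the second derivative, read off from second differences.\<close>

lemma second_difference_bound:
  fixes G :: "real ^ 'n \<Rightarrow> real ^ 'm"
  assumes "smooth G"
  obtains C where "\<And>r. 0 < r \<Longrightarrow> r < 1 \<Longrightarrow>
    norm (G (u + r *\<^sub>R v + r *\<^sub>R w) - G (u + r *\<^sub>R v) - G (u + r *\<^sub>R w) + G u
      - r\<^sup>2 *\<^sub>R D G u [v, w]) \<le> C * r ^ 3"
proof -
  \<comment> \<open>All four vertices of the parallelogram lie in the ball of this radius because
    \<open>r < 1\<close>.\<close>
  define R where "R = norm u + norm v + norm w"
  have sums: "(\<Sum>m\<le>2. F m) = F 0 + F 1 + F 2" "(\<Sum>m\<le>1. F m) = F 0 + F 1"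
    for F :: "nat \<Rightarrow> real ^ 'm"
    by (simp_all add: numeral_2_eq_2)
  have scal: "D G x [r *\<^sub>R w] = r *\<^sub>R D G x [w]" "D G x [r *\<^sub>R w, r *\<^sub>R w] = r\<^sup>2 *\<^sub>R D G x [w, w]"
    "D G x [r *\<^sub>R v, w] = r *\<^sub>R D G x [v, w]" for r x
    using D_map_scaleR[of G x r "[w]"] D_map_scaleR[of G x r "[w, w]"]
    by (simp_all add: power2_eq_square D_pair D_single scaleR_right.sum mult_ac)
  obtain C1 where "0 \<le> C1" and C1: "\<And>x y vs. x \<in> cball 0 R \<Longrightarrow> y \<in> cball 0 R \<Longrightarrow> length vs = 0 \<Longrightarrow>
      norm (D G y vs - (\<Sum>m\<le>2. (1 / fact m) *\<^sub>R D G x (replicate m (y - x) @ vs)))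
        \<le> C1 * norm (y - x) ^ Suc 2 * prod_list (map norm vs)"
    by (rule D_Taylor[OF assms]) blast
  obtain C2 where "0 \<le> C2" and C2: "\<And>x y vs. x \<in> cball 0 R \<Longrightarrow> y \<in> cball 0 R \<Longrightarrow> length vs = 1 \<Longrightarrow>
      norm (D G y vs - (\<Sum>m\<le>1. (1 / fact m) *\<^sub>R D G x (replicate m (y - x) @ vs)))
        \<le> C2 * norm (y - x) ^ Suc 1 * prod_list (map norm vs)"
    by (rule D_Taylor[OF assms]) blast
  obtain C3 where "0 \<le> C3" and C3: "\<And>x y vs. x \<in> cball 0 R \<Longrightarrow> y \<in> cball 0 R \<Longrightarrow> length vs = 2 \<Longrightarrow>
      norm (D G y vs - (\<Sum>m\<le>0. (1 / fact m) *\<^sub>R D G x (replicate m (y - x) @ vs)))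
        \<le> C3 * norm (y - x) ^ Suc 0 * prod_list (map norm vs)"
    by (rule D_Taylor[OF assms]) blast
  have "norm (G (u + r *\<^sub>R v + r *\<^sub>R w) - G (u + r *\<^sub>R v) - G (u + r *\<^sub>R w) + G u
      - r\<^sup>2 *\<^sub>R D G u [v, w])
      \<le> (2 * C1 * norm w ^ 3 + C2 * (norm v)\<^sup>2 * norm w + C3 * norm v * (norm w)\<^sup>2) * r ^ 3"
    (is "norm ?d \<le> _") if r: "0 < r" "r < 1" for r
  proof -
    let ?x = "u + r *\<^sub>R v"
    \<comment> \<open>\<open>E1 x\<close> is the error of the second-order expansion at
      \<open>x\<close> in direction \<open>w\<close>. Comparing \<open>?x\<close> with
      \<open>u\<close> leaves \<open>r\<close> times the change of \<open>D G _ [w]\<close>, whose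
      linear part is the wanted term and whose error is \<open>E2\<close>, and half of
      \<open>r\<^sup>2\<close> times the change \<open>E3\<close> of the quadratic term.\<close>
    define E1 where "E1 x = G (x + r *\<^sub>R w) - (G x + r *\<^sub>R D G x [w] + (r\<^sup>2 / 2) *\<^sub>R D G x [w, w])" for x
    define E2 where "E2 = D G ?x [w] - (D G u [w] + r *\<^sub>R D G u [v, w])"
    define E3 where "E3 = D G ?x [w, w] - D G u [w, w]"
    have rv: "norm (r *\<^sub>R v) \<le> norm v" "norm (r *\<^sub>R w) \<le> norm w"
      using r by (auto intro: mult_left_le_one_le)
    have "norm ?x \<le> norm u + norm v" "norm (?x + r *\<^sub>R w) \<le> norm u + norm v + norm w"
      "norm (u + r *\<^sub>R w) \<le> norm u + norm w"
      using rv norm_triangle_le by (meson add_mono order_refl order_trans)+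
    then have ball: "u \<in> cball 0 R" "?x \<in> cball 0 R" "u + r *\<^sub>R w \<in> cball 0 R"
        "?x + r *\<^sub>R w \<in> cball 0 R"
      using norm_ge_zero[of v] norm_ge_zero[of w] unfolding mem_cball_0 R_def by linarith+
    have E1: "norm (E1 x) \<le> C1 * norm w ^ 3 * r ^ 3"
      if "x \<in> cball 0 R" "x + r *\<^sub>R w \<in> cball 0 R" for x
      using C1[OF that, of "[]"] r
      by (simp add: E1_def sums scal numeral_2_eq_2 power_mult_distrib numeral_3_eq_3 mult_ac)
    have E2: "norm E2 \<le> C2 * (norm v)\<^sup>2 * norm w * r\<^sup>2"
      using C2[OF ball(1,2), of "[w]"] r
      by (simp add: E2_def sums scal power_mult_distrib power2_eq_square mult_ac)
    have E3: "norm E3 \<le> C3 * norm v * (norm w)\<^sup>2 * r"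
      using C3[OF ball(1,2), of "[w, w]"] r
      by (simp add: E3_def power2_eq_square mult_ac)
    have "?d = E1 ?x - E1 u + r *\<^sub>R E2 + (r\<^sup>2 / 2) *\<^sub>R E3"
      by (simp add: E1_def E2_def E3_def scaleR_diff_right scaleR_add_right power2_eq_square)
    also have "norm \<dots> \<le> norm (E1 ?x) + norm (E1 u) + r * norm E2 + (r\<^sup>2 / 2) * norm E3"
      using r by (intro order_trans[OF norm_triangle_ineq] add_mono norm_triangle_ineq4) auto
    also have "\<dots> \<le> C1 * norm w ^ 3 * r ^ 3 + C1 * norm w ^ 3 * r ^ 3
        + r * (C2 * (norm v)\<^sup>2 * norm w * r\<^sup>2) + r\<^sup>2 * (C3 * norm v * (norm w)\<^sup>2 * r)"
      using r by (intro add_mono mult_mono E1 E2 E3 ball) auto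
    also have "\<dots> = (2 * C1 * norm w ^ 3 + C2 * (norm v)\<^sup>2 * norm w + C3 * norm v * (norm w)\<^sup>2) * r ^ 3"
      by (simp add: algebra_simps power2_eq_square power3_eq_cube)
    finally show ?thesis .
  qed
  then show ?thesis by (rule that)
qed

text \<open>The second difference is symmetric in \<open>v\<close> and \<open>w\<close>, and it
  agrees with \<open>r\<^sup>2\<close> times either side up to order 3 in \<open>r\<close>. Division
  by \<open>r\<^sup>2\<close> and \<open>r\<close> tending to 0 give the equality.\<close>

lemma D_pair_commute:
  assumes "smooth G"
  shows "D G u [v, w] = D G u [w, v]"
proof -
  obtain C1 where C1: "\<And>r. 0 < r \<Longrightarrow> r < 1 \<Longrightarrow>
      norm (G (u + r *\<^sub>R v + r *\<^sub>R w) - G (u + r *\<^sub>R v) - G (u + r *\<^sub>R w) + G u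
        - r\<^sup>2 *\<^sub>R D G u [v, w]) \<le> C1 * r ^ 3"
    by (rule second_difference_bound[OF assms]) blast
  obtain C2 where C2: "\<And>r. 0 < r \<Longrightarrow> r < 1 \<Longrightarrow>
      norm (G (u + r *\<^sub>R w + r *\<^sub>R v) - G (u + r *\<^sub>R w) - G (u + r *\<^sub>R v) + G u
        - r\<^sup>2 *\<^sub>R D G u [w, v]) \<le> C2 * r ^ 3"
    by (rule second_difference_bound[OF assms]) blast
  have bd: "norm (D G u [v, w] - D G u [w, v]) \<le> (C1 + C2) * r" if r: "0 < r" "r < 1" for r
  proof -
    have "norm (r\<^sup>2 *\<^sub>R (D G u [v, w] - D G u [w, v])) \<le> C2 * r ^ 3 + C1 * r ^ 3"
      using order_trans[OF norm_triangle_ineq4 add_mono[OF C2[OF r] C1[OF r]]]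
      by (simp add: algebra_simps)
    then have "r\<^sup>2 * norm (D G u [v, w] - D G u [w, v]) \<le> r\<^sup>2 * ((C1 + C2) * r)"
      unfolding norm_scaleR by (simp add: algebra_simps power2_eq_square power3_eq_cube)
    then show ?thesis using r by simp
  qed
  have "((\<lambda>r. (C1 + C2) * r) \<longlongrightarrow> 0) (at_right 0)"
    by (auto intro!: tendsto_eq_intros)
  moreover have "\<forall>\<^sub>F r in at_right 0. norm (D G u [v, w] - D G u [w, v]) \<le> (C1 + C2) * r"
    using bd by (auto intro!: eventually_at_rightI[of 0 1])
  ultimately have "norm (D G u [v, w] - D G u [w, v]) \<le> 0"
    by (rule tendsto_lowerbound) simp
  then show ?thesis by simp
qed

lemma linear_D_Cons: "smooth G \<Longrightarrow> linear (\<lambda>v. D G u (v # vs))"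
  by (rule has_derivative_linear[OF D_has_derivative])

lemma linear_D_snoc: "linear (\<lambda>v. D G u (vs @ [v]))"
  by (rule linearI) (simp_all add: D_snoc scaleR_add_left sum.distrib scaleR_right.sum)

section \<open>Two-parameter functions of Hoelder order\<close>

text \<open>Since \<open>0 powr p = 0\<close>, even for \<open>p = 0\<close>, such an \<open>F\<close> vanishes on the diagonal.\<close>

definition hoelder_order ::
  "real \<Rightarrow> real \<Rightarrow> (real \<Rightarrow> real \<Rightarrow> 'a::real_normed_vector) \<Rightarrow> bool" where
  "hoelder_order T p F \<longleftrightarrow>
     (\<exists>C. \<forall>s\<in>{0..T}. \<forall>t\<in>{0..T}. norm (F s t) \<le> C * \<bar>t - s\<bar> powr p)"

lemma hoelder_orderE:
  assumes "hoelder_order T p F"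
  obtains C where "0 \<le> C" "\<And>s t. s \<in> {0..T} \<Longrightarrow> t \<in> {0..T} \<Longrightarrow> norm (F s t) \<le> C * \<bar>t - s\<bar> powr p"
proof -
  obtain C where C: "\<And>s t. s \<in> {0..T} \<Longrightarrow> t \<in> {0..T} \<Longrightarrow> norm (F s t) \<le> C * \<bar>t - s\<bar> powr p"
    using assms unfolding hoelder_order_def by blast
  have "norm (F s t) \<le> \<bar>C\<bar> * \<bar>t - s\<bar> powr p" if "s \<in> {0..T}" "t \<in> {0..T}" for s t
    using C[OF that] by (rule order_trans) (simp add: mult_right_mono)
  then show ?thesis by (intro that[of "\<bar>C\<bar>"]) auto
qed

lemma hoelder_orderI:
  "(\<And>s t. s \<in> {0..T} \<Longrightarrow> t \<in> {0..T} \<Longrightarrow> norm (F s t) \<le> C * \<bar>t - s\<bar> powr p) \<Longrightarrow> hoelder_order T p F"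
  unfolding hoelder_order_def by blast

lemma hoelder_order_cong:
  assumes "\<And>s t. s \<in> {0..T} \<Longrightarrow> t \<in> {0..T} \<Longrightarrow> F s t = G s t" and "hoelder_order T p G"
  shows "hoelder_order T p F"
  using assms unfolding hoelder_order_def by simp

lemma hoelder_order_bilinear_bound:
  assumes "hoelder_order T p F" "hoelder_order T q G" "0 \<le> B"
    and H: "\<And>s t. s \<in> {0..T} \<Longrightarrow> t \<in> {0..T} \<Longrightarrow> norm (H s t) \<le> B * (norm (F s t) * norm (G s t))"
  shows "hoelder_order T (p + q) H"
proof -
  obtain C1 where C1: "0 \<le> C1" "\<And>s t. s \<in> {0..T} \<Longrightarrow> t \<in> {0..T} \<Longrightarrow> norm (F s t) \<le> C1 * \<bar>t - s\<bar> powr p"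
    using assms(1) by (rule hoelder_orderE) blast
  obtain C2 where C2: "0 \<le> C2" "\<And>s t. s \<in> {0..T} \<Longrightarrow> t \<in> {0..T} \<Longrightarrow> norm (G s t) \<le> C2 * \<bar>t - s\<bar> powr q"
    using assms(2) by (rule hoelder_orderE) blast
  show ?thesis
  proof (rule hoelder_orderI)
    fix s t assume st: "s \<in> {0..T}" "t \<in> {0..T}"
    have "norm (H s t) \<le> B * ((C1 * \<bar>t - s\<bar> powr p) * (C2 * \<bar>t - s\<bar> powr q))"
      using C1 C2 st assms(3)
      by (intro order_trans[OF H[OF st]] mult_left_mono mult_mono) auto
    then show "norm (H s t) \<le> (B * C1 * C2) * \<bar>t - s\<bar> powr (p + q)"
      by (simp add: powr_add mult_ac)
  qed
qed

text \<open>The power is \<open>Suc k\<close> because a zeroth power would be the constant 1, which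
  does not vanish on the diagonal and so has no order in this sense.\<close>

lemma hoelder_order_power_bound:
  assumes "hoelder_order T p F" "0 \<le> B"
    and H: "\<And>s t. s \<in> {0..T} \<Longrightarrow> t \<in> {0..T} \<Longrightarrow> norm (H s t) \<le> B * norm (F s t) ^ Suc k"
  shows "hoelder_order T (real (Suc k) * p) H"
proof -
  obtain C where C: "0 \<le> C" "\<And>s t. s \<in> {0..T} \<Longrightarrow> t \<in> {0..T} \<Longrightarrow> norm (F s t) \<le> C * \<bar>t - s\<bar> powr p"
    using assms(1) by (rule hoelder_orderE) blast
  have pow: "(x powr p) ^ Suc k = x powr (real (Suc k) * p)" for x :: real
    by (induction k) (simp_all add: algebra_simps flip: powr_add)
  show ?thesis
  proof (rule hoelder_orderI)
    fix s t assume st: "s \<in> {0..T}" "t \<in> {0..T}"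
    have "norm (H s t) \<le> B * (C * \<bar>t - s\<bar> powr p) ^ Suc k"
      using C st assms(2)
      by (intro order_trans[OF H[OF st]] mult_left_mono power_mono) auto
    then show "norm (H s t) \<le> (B * C ^ Suc k) * \<bar>t - s\<bar> powr (real (Suc k) * p)"
      unfolding power_mult_distrib pow by (simp add: mult.assoc)
  qed
qed

lemma hoelder_order_bound:
  assumes "hoelder_order T p F" "0 \<le> B"
    and "\<And>s t. s \<in> {0..T} \<Longrightarrow> t \<in> {0..T} \<Longrightarrow> norm (H s t) \<le> B * norm (F s t)"
  shows "hoelder_order T p H"
  using hoelder_order_power_bound[of T p F B H 0] assms by simp

text \<open>As \<open>\<bar>t - s\<bar> \<le> T\<close>, the surplus power \<open>p - q\<close> is
  absorbed into the constant.\<close>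

lemma hoelder_order_mono:
  assumes "hoelder_order T p F" "q \<le> p"
  shows "hoelder_order T q F"
proof -
  obtain C where C: "0 \<le> C" "\<And>s t. s \<in> {0..T} \<Longrightarrow> t \<in> {0..T} \<Longrightarrow> norm (F s t) \<le> C * \<bar>t - s\<bar> powr p"
    using assms(1) by (rule hoelder_orderE) blast
  show ?thesis
  proof (rule hoelder_orderI)
    fix s t assume st: "s \<in> {0..T}" "t \<in> {0..T}"
    have "\<bar>t - s\<bar> powr p = \<bar>t - s\<bar> powr (p - q) * \<bar>t - s\<bar> powr q"
      by (simp flip: powr_add)
    also have "\<dots> \<le> T powr (p - q) * \<bar>t - s\<bar> powr q"
      using st assms(2) by (intro mult_right_mono powr_mono2) auto
    finally have "C * \<bar>t - s\<bar> powr p \<le> C * (T powr (p - q) * \<bar>t - s\<bar> powr q)"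
      using C(1) by (rule mult_left_mono)
    then show "norm (F s t) \<le> (C * T powr (p - q)) * \<bar>t - s\<bar> powr q"
      using C(2)[OF st] by simp
  qed
qed

lemma hoelder_order_add:
  assumes "hoelder_order T p F" "hoelder_order T p G"
  shows "hoelder_order T p (\<lambda>s t. F s t + G s t)"
proof -
  obtain C1 where C1: "\<And>s t. s \<in> {0..T} \<Longrightarrow> t \<in> {0..T} \<Longrightarrow> norm (F s t) \<le> C1 * \<bar>t - s\<bar> powr p"
    using assms(1) by (rule hoelder_orderE) blast
  obtain C2 where C2: "\<And>s t. s \<in> {0..T} \<Longrightarrow> t \<in> {0..T} \<Longrightarrow> norm (G s t) \<le> C2 * \<bar>t - s\<bar> powr p"
    using assms(2) by (rule hoelder_orderE) blast
  show ?thesis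
    using norm_triangle_mono[OF C1 C2]
    by (intro hoelder_orderI[where C = "C1 + C2"]) (auto simp: distrib_right)
qed

lemma hoelder_order_zero: "hoelder_order T p (\<lambda>s t. 0)"
  by (rule hoelder_orderI[where C = 0]) simp

lemma hoelder_order_cmult: "hoelder_order T p F \<Longrightarrow> hoelder_order T p (\<lambda>s t. c *\<^sub>R F s t)"
  by (rule hoelder_order_bound[where B = "\<bar>c\<bar>" and F = F]) auto

lemma hoelder_order_sum:
  "(\<And>i. i \<in> I \<Longrightarrow> hoelder_order T p (F i)) \<Longrightarrow> hoelder_order T p (\<lambda>s t. \<Sum>i\<in>I. F i s t)"
  by (induction I rule: infinite_finite_induct)
     (simp_all add: hoelder_order_zero hoelder_order_add)

lemma hoelder_order_scaleR_bounded:
  assumes "hoelder_order T p x" and "\<And>s t. s \<in> {0..T} \<Longrightarrow> t \<in> {0..T} \<Longrightarrow> norm (v s t) \<le> M"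
  shows "hoelder_order T p (\<lambda>s t. x s t *\<^sub>R v s t)"
proof (rule hoelder_order_bound[OF assms(1), where B = "\<bar>M\<bar>"])
  fix s t assume st: "s \<in> {0..T}" "t \<in> {0..T}"
  show "norm (x s t *\<^sub>R v s t) \<le> \<bar>M\<bar> * norm (x s t)"
    using mult_left_mono[OF order_trans[OF assms(2)[OF st] abs_ge_self], of "\<bar>x s t\<bar>"]
    by (simp add: mult.commute)
qed simp

section \<open>Increments of compositions\<close>

lemma D_single_order:
  assumes "smooth G" "\<And>s t. s \<in> {0..T} \<Longrightarrow> t \<in> {0..T} \<Longrightarrow> z s t \<in> cball 0 R"
    and "hoelder_order T p v"
  shows "hoelder_order T p (\<lambda>s t. D G (z s t) [v s t])"
proof -
  obtain B where "0 \<le> B" "\<And>u vs. u \<in> cball 0 R \<Longrightarrow> length vs = 1 \<Longrightarrow>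
      norm (D G u vs) \<le> B * prod_list (map norm vs)"
    by (rule D_bounded[OF assms(1) compact_cball]) blast
  from this(1) this(2)[of _ "[v _ _]"] assms(2) show ?thesis
    by (intro hoelder_order_bound[OF assms(3)]) auto
qed

lemma D_pair_order:
  assumes "smooth G" "\<And>s t. s \<in> {0..T} \<Longrightarrow> t \<in> {0..T} \<Longrightarrow> z s t \<in> cball 0 R"
    and "hoelder_order T p v" "hoelder_order T q w"
  shows "hoelder_order T (p + q) (\<lambda>s t. D G (z s t) [v s t, w s t])"
proof -
  obtain B where "0 \<le> B" "\<And>u vs. u \<in> cball 0 R \<Longrightarrow> length vs = 2 \<Longrightarrow>
      norm (D G u vs) \<le> B * prod_list (map norm vs)"
    by (rule D_bounded[OF assms(1) compact_cball]) blast
  from this(1) this(2)[of _ "[v _ _, w _ _]"] assms(2) show ?thesis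
    by (intro hoelder_order_bilinear_bound[OF assms(3,4)]) auto
qed

lemma D_pair_order_bounded:
  assumes "smooth G" "\<And>s t. s \<in> {0..T} \<Longrightarrow> t \<in> {0..T} \<Longrightarrow> z s t \<in> cball 0 R"
    and v: "hoelder_order T p v" and w: "\<And>s t. s \<in> {0..T} \<Longrightarrow> t \<in> {0..T} \<Longrightarrow> norm (w s t) \<le> M"
  shows "hoelder_order T p (\<lambda>s t. D G (z s t) [v s t, w s t])"
proof -
  obtain B where B: "0 \<le> B" "\<And>u vs. u \<in> cball 0 R \<Longrightarrow> length vs = 2 \<Longrightarrow>
      norm (D G u vs) \<le> B * prod_list (map norm vs)"
    by (rule D_bounded[OF assms(1) compact_cball]) blast
  show ?thesis
  proof (rule hoelder_order_bound[OF v, where B = "B * \<bar>M\<bar>"])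
    fix s t assume st: "s \<in> {0..T}" "t \<in> {0..T}"
    have "norm (D G (z s t) [v s t, w s t]) \<le> B * (norm (v s t) * norm (w s t))"
      using B(2)[OF assms(2)[OF st], of "[v s t, w s t]"] by simp
    also have "\<dots> \<le> B * (norm (v s t) * \<bar>M\<bar>)"
      using B(1) w[OF st] by (intro mult_left_mono) auto
    finally show "norm (D G (z s t) [v s t, w s t]) \<le> B * \<bar>M\<bar> * norm (v s t)"
      by (simp add: mult_ac)
  qed (use B(1) in simp)
qed

lemma D_Taylor_order:
  assumes "smooth G" and y: "\<And>t. t \<in> {0..T} \<Longrightarrow> y t \<in> cball 0 R"
    and incr: "hoelder_order T p (\<lambda>s t. y t - y s)"
    and l: "\<And>s t. length (vs s t) = l"
    and M: "\<And>s t. s \<in> {0..T} \<Longrightarrow> t \<in> {0..T} \<Longrightarrow> prod_list (map norm (vs s t)) \<le> M"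
  shows "hoelder_order T (real (Suc k) * p) (\<lambda>s t. D G (y t) (vs s t)
    - (\<Sum>m\<le>k. (1 / fact m) *\<^sub>R D G (y s) (replicate m (y t - y s) @ vs s t)))"
proof -
  obtain C where C: "0 \<le> C" "\<And>x y vs. x \<in> cball 0 R \<Longrightarrow> y \<in> cball 0 R \<Longrightarrow> length vs = l \<Longrightarrow>
      norm (D G y vs - (\<Sum>m\<le>k. (1 / fact m) *\<^sub>R D G x (replicate m (y - x) @ vs)))
        \<le> C * norm (y - x) ^ Suc k * prod_list (map norm vs)"
    by (rule D_Taylor[OF assms(1)]) blast
  show ?thesis
  proof (rule hoelder_order_power_bound[OF incr, where B = "C * \<bar>M\<bar>"])
    fix s t assume st: "s \<in> {0..T}" "t \<in> {0..T}"
    have "C * norm (y t - y s) ^ Suc k * prod_list (map norm (vs s t))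
        \<le> C * norm (y t - y s) ^ Suc k * \<bar>M\<bar>"
      using C(1) M[OF st] by (intro mult_left_mono) auto
    from order_trans[OF C(2)[OF y[OF st(1)] y[OF st(2)] l[of s t]] this]
    show "norm (D G (y t) (vs s t)
        - (\<Sum>m\<le>k. (1 / fact m) *\<^sub>R D G (y s) (replicate m (y t - y s) @ vs s t)))
        \<le> C * \<bar>M\<bar> * norm (y t - y s) ^ Suc k"
      by (simp only: mult_ac)
  qed (use C(1) in simp)
qed

lemma D_Lipschitz_order:
  assumes "smooth G" and y: "\<And>t. t \<in> {0..T} \<Longrightarrow> y t \<in> cball 0 R"
    and incr: "hoelder_order T p (\<lambda>s t. y t - y s)" and v: "hoelder_order T q v"
  shows "hoelder_order T (p + q) (\<lambda>s t. D G (y t) [v s t] - D G (y s) [v s t])"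
proof -
  obtain C where C: "0 \<le> C" "\<And>x y vs. x \<in> cball 0 R \<Longrightarrow> y \<in> cball 0 R \<Longrightarrow> length vs = 1 \<Longrightarrow>
      norm (D G y vs - (\<Sum>m\<le>0. (1 / fact m) *\<^sub>R D G x (replicate m (y - x) @ vs)))
        \<le> C * norm (y - x) ^ Suc 0 * prod_list (map norm vs)"
    by (rule D_Taylor[OF assms(1)]) blast
  show ?thesis
    by (rule hoelder_order_bilinear_bound[OF incr v C(1)])
       (use C(2)[OF y y, of _ _ "[v _ _]"] in \<open>simp add: mult.assoc\<close>)
qed

text \<open>The first-order Taylor error is of order \<open>2 * p\<close>, and so is the cost of
  replacing the increment of \<open>y\<close> by its leading part \<open>L\<close> inside the linear
  term.\<close>

lemma composition_order_2:
  assumes "smooth G" and y: "\<And>t. t \<in> {0..T} \<Longrightarrow> y t \<in> cball 0 R" and "0 \<le> p"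
    and L: "hoelder_order T p L" and e: "hoelder_order T (2 * p) (\<lambda>s t. y t - y s - L s t)"
  shows "hoelder_order T (2 * p) (\<lambda>s t. G (y t) - G (y s) - D G (y s) [L s t])"
proof -
  have "hoelder_order T p (\<lambda>s t. y t - y s - L s t + L s t)"
    using assms(3) by (intro hoelder_order_add L hoelder_order_mono[OF e]) auto
  then have incr: "hoelder_order T p (\<lambda>s t. y t - y s)" by simp
  have "hoelder_order T (2 * p) (\<lambda>s t. (G (y t) - G (y s) - D G (y s) [y t - y s])
      + D G (y s) [y t - y s - L s t])"
    using D_Taylor_order[OF assms(1) y incr, of "\<lambda>s t. []" 0 1 1] y
    by (intro hoelder_order_add D_single_order[OF assms(1) _ e]) (auto simp: algebra_simps)
  then show ?thesis
    by (rule hoelder_order_cong[rotated])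
       (simp add: linear_diff[OF linear_D_Cons[OF assms(1)]])
qed

text \<open>The increment of \<open>y\<close> is \<open>L + Q\<close> up to order
  \<open>3 * p\<close>. In the quadratic Taylor term only the pair \<open>L, L\<close> survives,
  since every other pair has order at least \<open>3 * p\<close>.\<close>

lemma composition_order_3:
  assumes "smooth G" and y: "\<And>t. t \<in> {0..T} \<Longrightarrow> y t \<in> cball 0 R" and "0 \<le> p"
    and L: "hoelder_order T p L" and Q: "hoelder_order T (2 * p) Q"
    and e: "hoelder_order T (3 * p) (\<lambda>s t. y t - y s - L s t - Q s t)"
  shows "hoelder_order T (3 * p) (\<lambda>s t. G (y t) - G (y s) - D G (y s) [L s t] - D G (y s) [Q s t]
    - (1 / 2) *\<^sub>R D G (y s) [L s t, L s t])"
proof -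
  have "hoelder_order T (2 * p) (\<lambda>s t. y t - y s - L s t - Q s t + Q s t)"
    using assms(3) by (intro hoelder_order_add Q hoelder_order_mono[OF e]) auto
  then have e2: "hoelder_order T (2 * p) (\<lambda>s t. y t - y s - L s t)" by simp
  have "hoelder_order T p (\<lambda>s t. y t - y s - L s t + L s t)"
    using assms(3) by (intro hoelder_order_add L hoelder_order_mono[OF e2]) auto
  then have incr: "hoelder_order T p (\<lambda>s t. y t - y s)" by simp
  have "hoelder_order T (3 * p) (\<lambda>s t. D G (y t) []
      - (\<Sum>m\<le>2. (1 / fact m) *\<^sub>R D G (y s) (replicate m (y t - y s) @ [])))"
    using D_Taylor_order[OF assms(1) y incr, of "\<lambda>s t. []" 0 1 2] by simp
  moreover have "hoelder_order T (3 * p) (\<lambda>s t. D G (y s) [y t - y s - L s t - Q s t])"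
    using y by (intro D_single_order[OF assms(1) _ e])
  \<comment> \<open>This and the next bound replace both arguments of the quadratic term by
    \<open>L\<close>, one at a time, through the bilinear identity D[h, h] - D[L, L] = D[h - L, h] +
    D[L, h - L] for the increment h of \<open>y\<close>.\<close>
  moreover have "hoelder_order T (2 * p + p) (\<lambda>s t. D G (y s) [y t - y s - L s t, y t - y s])"
    using y by (intro D_pair_order[OF assms(1) _ e2 incr])
  moreover have "hoelder_order T (p + 2 * p) (\<lambda>s t. D G (y s) [L s t, y t - y s - L s t])"
    using y by (intro D_pair_order[OF assms(1) _ L e2])
  ultimately have "hoelder_order T (3 * p) (\<lambda>s t. (D G (y t) []
      - (\<Sum>m\<le>2. (1 / fact m) *\<^sub>R D G (y s) (replicate m (y t - y s) @ [])))
      + D G (y s) [y t - y s - L s t - Q s t]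
      + (1 / 2) *\<^sub>R (D G (y s) [y t - y s - L s t, y t - y s] + D G (y s) [L s t, y t - y s - L s t]))"
    by (intro hoelder_order_add hoelder_order_cmult) (auto simp: algebra_simps)
  then show ?thesis
    by (rule hoelder_order_cong[rotated])
       (simp add: numeral_2_eq_2 linear_diff[OF linear_D_Cons[OF assms(1)]]
          linear_diff[OF linear_D_snoc[of G _ "[_]", simplified]] scaleR_right_distrib scaleR_right_diff_distrib)
qed

lemma composition_deriv_order_1:
  assumes "smooth G" and y: "\<And>t. t \<in> {0..T} \<Longrightarrow> y t \<in> cball 0 R"
    and incr: "hoelder_order T p (\<lambda>s t. y t - y s)"
    and w: "hoelder_order T p (\<lambda>s t. w t - w s)" and M: "\<And>t. t \<in> {0..T} \<Longrightarrow> norm (w t) \<le> M"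
  shows "hoelder_order T p (\<lambda>s t. D G (y t) [w t] - D G (y s) [w s])"
proof -
  have "hoelder_order T p (\<lambda>s t. D G (y t) [w t - w s] + (D G (y t) [w s] - D G (y s) [w s]))"
    using D_Taylor_order[OF assms(1) y incr, of "\<lambda>s t. [w s]" 1 M 0] M y
    by (intro hoelder_order_add D_single_order[OF assms(1) _ w]) auto
  then show ?thesis
    by (simp add: linear_diff[OF linear_D_Cons[OF assms(1)]])
qed

text \<open>A product rule for increments, with \<open>L\<close> and \<open>K\<close> as leading
  parts of the increments of \<open>y\<close> and \<open>w\<close>. The four errors come from
  replacing \<open>w t\<close> by \<open>w s + K s t\<close>, from moving the base point under
  \<open>K\<close> to \<open>y s\<close>, from the Taylor expansion of \<open>D G _ [w s]\<close>,
  and from replacing the increment of \<open>y\<close> by \<open>L\<close>.\<close>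

lemma composition_deriv_order_2:
  assumes "smooth G" and y: "\<And>t. t \<in> {0..T} \<Longrightarrow> y t \<in> cball 0 R" and "0 \<le> p"
    and L: "hoelder_order T p L" and e: "hoelder_order T (2 * p) (\<lambda>s t. y t - y s - L s t)"
    and K: "hoelder_order T p K" and w: "hoelder_order T (2 * p) (\<lambda>s t. w t - w s - K s t)"
    and M: "\<And>t. t \<in> {0..T} \<Longrightarrow> norm (w t) \<le> M"
  shows "hoelder_order T (2 * p) (\<lambda>s t. D G (y t) [w t] - D G (y s) [w s]
    - D G (y s) [L s t, w s] - D G (y s) [K s t])"
proof -
  have "hoelder_order T p (\<lambda>s t. y t - y s - L s t + L s t)"
    using assms(3) by (intro hoelder_order_add L hoelder_order_mono[OF e]) auto
  then have incr: "hoelder_order T p (\<lambda>s t. y t - y s)" by simp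
  have "hoelder_order T (2 * p) (\<lambda>s t. D G (y t) [w t - w s - K s t])"
    using y by (intro D_single_order[OF assms(1) _ w])
  moreover have "hoelder_order T (p + p) (\<lambda>s t. D G (y t) [K s t] - D G (y s) [K s t])"
    by (intro D_Lipschitz_order[OF assms(1) y incr K])
  moreover have "hoelder_order T (2 * p) (\<lambda>s t. D G (y t) [w s]
      - (\<Sum>m\<le>1. (1 / fact m) *\<^sub>R D G (y s) (replicate m (y t - y s) @ [w s])))"
    using D_Taylor_order[OF assms(1) y incr, of "\<lambda>s t. [w s]" 1 M 1] M by simp
  moreover have "hoelder_order T (2 * p) (\<lambda>s t. D G (y s) [y t - y s - L s t, w s])"
    using y M by (intro D_pair_order_bounded[OF assms(1) _ e])
  ultimately have "hoelder_order T (2 * p) (\<lambda>s t. D G (y t) [w t - w s - K s t]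
      + (D G (y t) [K s t] - D G (y s) [K s t])
      + (D G (y t) [w s] - (\<Sum>m\<le>1. (1 / fact m) *\<^sub>R D G (y s) (replicate m (y t - y s) @ [w s])))
      + D G (y s) [y t - y s - L s t, w s])"
    by (intro hoelder_order_add) (auto simp: algebra_simps)
  then show ?thesis
    by (rule hoelder_order_cong[rotated])
       (simp add: linear_diff[OF linear_D_Cons[OF assms(1)]])
qed

lemma composition_deriv2_order_1:
  assumes "smooth G" and y: "\<And>t. t \<in> {0..T} \<Longrightarrow> y t \<in> cball 0 R"
    and incr: "hoelder_order T p (\<lambda>s t. y t - y s)"
    and v: "hoelder_order T p (\<lambda>s t. v t - v s)" and w: "hoelder_order T p (\<lambda>s t. w t - w s)"
    and M: "\<And>t. t \<in> {0..T} \<Longrightarrow> norm (v t) \<le> M" "\<And>t. t \<in> {0..T} \<Longrightarrow> norm (w t) \<le> M"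
  shows "hoelder_order T p (\<lambda>s t. D G (y t) [v t, w t] - D G (y s) [v s, w s])"
proof -
  have "hoelder_order T p (\<lambda>s t. D G (y t) [v s, w s] - D G (y s) [v s, w s])"
  proof -
    have "norm (v s) * norm (w s) \<le> M * M" if "s \<in> {0..T}" for s
      using M[OF that] by (intro mult_mono) (auto intro: order_trans[OF norm_ge_zero])
    then show ?thesis
      using D_Taylor_order[OF assms(1) y incr, of "\<lambda>s t. [v s, w s]" 2 "M * M" 0] by simp
  qed
  moreover have "hoelder_order T p (\<lambda>s t. D G (y t) [v t - v s, w t])"
    using y M by (intro D_pair_order_bounded[OF assms(1) _ v])
  \<comment> \<open>The arguments are swapped because \<open>D_pair_order_bounded\<close> takes the
    small one first; symmetry of the second derivative restores the order at the end.\<close>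
  moreover have "hoelder_order T p (\<lambda>s t. D G (y t) [w t - w s, v s])"
    using y M by (intro D_pair_order_bounded[OF assms(1) _ w])
  ultimately have "hoelder_order T p (\<lambda>s t. D G (y t) [v t - v s, w t] + D G (y t) [w t - w s, v s]
      + (D G (y t) [v s, w s] - D G (y s) [v s, w s]))"
    by (intro hoelder_order_add)
  then show ?thesis
    by (rule hoelder_order_cong[rotated])
       (simp add: linear_diff[OF linear_D_Cons[OF assms(1)]]
          D_pair_commute[OF assms(1), of _ "w _" "v _"])
qed

section \<open>Forests and the coproduct\<close>

lemma sum_mset_image_sum_mset:
  "(\<Sum>y\<in>#(\<Sum>x\<in>#P. M x). F y) = (\<Sum>x\<in>#P. \<Sum>y\<in>#M x. F y)"
  by (induction P) auto

lemma sum_tensor_mult: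
  "(\<Sum>(e, g)\<in>#tensor_mult P Q. F e g) =
     (\<Sum>(a, b)\<in>#P. \<Sum>(c, d)\<in>#Q. \<Sum>e\<in>#shuffle a c. F e (b @ d))"
  unfolding tensor_mult_def
  by (simp add: sum_mset_image_sum_mset case_prod_unfold image_mset.compositionality o_def)

lemma tensor_mult_unit: "tensor_mult {#([], [])#} Q = Q"
  by (simp add: tensor_mult_def case_prod_unfold)

lemma coproduct_Node:
  "coproduct [Node i \<tau>] =
     add_mset ([Node i \<tau>], []) (image_mset (\<lambda>(a, b). (a, [Node i b])) (coproduct \<tau>))"
  using coproduct.simps(2)[of "[]" i \<tau>] by (simp add: tensor_mult_unit)

lemma coproduct_bullet: "coproduct [Node i []] = {#([Node i []], []), ([], [Node i []])#}"
  by (simp add: coproduct_Node)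

lemma coproduct_ladder:
  "coproduct [Node i [Node j []]] =
     {#([Node i [Node j []]], []), ([Node j []], [Node i []]), ([], [Node i [Node j []]])#}"
  by (simp add: coproduct_Node)

text \<open>Of the two bullets only the left one can be cut off alone: the cuts are left
  admissible.\<close>

lemma coproduct_two_bullets:
  "coproduct [Node i [], Node j []] =
     {#([Node i [], Node j []], []), ([Node i []], [Node j []]), ([], [Node i [], Node j []])#}"
  using coproduct.simps(2)[of "[Node i []]" j "[]"]
  by (simp add: coproduct_bullet tensor_mult_def)

section \<open>Grading of the coproduct and the unit of the dual product\<close>

lemma sum_mset_subtractf:
  fixes f g :: "'a \<Rightarrow> 'b::ab_group_add"
  shows "(\<Sum>x\<in>#M. f x - g x) = (\<Sum>x\<in>#M. f x) - (\<Sum>x\<in>#M. g x)"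
  by (induction M) (simp_all add: algebra_simps)

lemma forest_size_shuffle: "e \<in># shuffle a c \<Longrightarrow> forest_size e = forest_size a + forest_size c"
  by (induction a c arbitrary: e rule: shuffle.induct) (auto simp: forest_size_def)

lemma forest_size_coproduct:
  "(a, b) \<in># coproduct \<tau> \<Longrightarrow> forest_size a + forest_size b = forest_size \<tau>"
proof (induction \<tau> arbitrary: a b rule: coproduct.induct)
  case 1
  then show ?case by (simp add: forest_size_def)
next
  case (2 \<omega> i \<tau>)
  from "2.prems" consider "a = \<omega> @ [Node i \<tau>]" "b = []"
    | a1 b1 a2 b2 where "(a1, b1) \<in># coproduct \<omega>" "(a2, b2) \<in># coproduct \<tau>"
        "a \<in># shuffle a1 a2" "b = b1 @ [Node i b2]"
    by (auto simp: tensor_mult_def)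
  then show ?case
  proof cases
    case 2
    then show ?thesis
      using "2.IH" forest_size_shuffle by (fastforce simp: forest_size_def)
  qed (simp add: forest_size_def)
qed

text \<open>The counit \<open>basis []\<close> is a character of the shuffle product, because a
  shuffle is empty only if both words are.\<close>

lemma sum_shuffle_basis_Nil:
  "(\<Sum>e\<in>#shuffle a c. basis [] e) = basis [] a * basis [] c"
  by (induction a c rule: shuffle.induct)
     (auto simp: basis_def image_mset.compositionality o_def)

lemma star_snoc:
  "(x \<star> y) (\<omega> @ [Node i \<tau>]) = x (\<omega> @ [Node i \<tau>]) * y [] +
     (\<Sum>(a, b)\<in>#coproduct \<omega>. \<Sum>(c, d)\<in>#coproduct \<tau>.
        (\<Sum>e\<in>#shuffle a c. x e) * y (b @ [Node i d]))"
  unfolding star_def coproduct.simps image_mset_union sum_mset.union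
    sum_tensor_mult[of "\<lambda>e g. x e * y g"]
  by (simp add: image_mset.compositionality o_def case_prod_unfold sum_mset_distrib_right)

lemma star_basis_Nil_right: "(x \<star> basis []) \<tau> = x \<tau>"
proof (cases \<tau> rule: rev_cases)
  case Nil
  then show ?thesis by (simp add: star_def basis_def)
next
  case (snoc \<omega> t)
  then show ?thesis
    by (cases t) (simp add: star_snoc basis_def case_prod_unfold)
qed

text \<open>Multiplicativity of the counit splits the pairing into two nested products, one over
  \<open>\<omega>\<close> and one over \<open>\<tau>\<close>. The induction hypotheses are applied
  to them with modified second factors, which is why \<open>y\<close> varies.\<close>

lemma star_basis_Nil_left: "(basis [] \<star> y) \<tau> = y \<tau>"
proof (induction \<tau> arbitrary: y rule: coproduct.induct)
  case 1
  then show ?case by (simp add: star_def basis_def)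
next
  case (2 \<omega> i \<tau>)
  have "(basis [] \<star> y) (\<omega> @ [Node i \<tau>]) =
      (basis [] \<star> (\<lambda>b. (basis [] \<star> (\<lambda>d. y (b @ [Node i d]))) \<tau>)) \<omega>"
    by (simp add: star_snoc sum_shuffle_basis_Nil)
       (simp add: star_def basis_def case_prod_unfold sum_mset_distrib_left mult.assoc)
  then show ?case using "2.IH" by simp
qed

lemma star_Node:
  "(x \<star> y) [Node i \<tau>] = x [Node i \<tau>] * y [] + (\<Sum>(a, b)\<in>#coproduct \<tau>. x a * y [Node i b])"
  by (simp add: star_def coproduct_Node image_mset.compositionality o_def case_prod_unfold)

text \<open>The product of \<open>x - basis []\<close> with itself is computed in two ways. Term by
  term it vanishes on \<open>\<tau>\<close>: a cut with an empty side contributes a zero factor, and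
  any other cut has a smaller nonempty left side, where \<open>x\<close> is 0 by induction. By
  idempotency and the unit laws it equals \<open>basis [] - x\<close>. The lemma serves to evaluate
  a rough path on the diagonal.\<close>

lemma star_idempotent_trivial:
  assumes "x [] = 1" and idem: "\<And>\<tau>. forest_size \<tau> \<le> N \<Longrightarrow> (x \<star> x) \<tau> = x \<tau>"
    and "forest_size \<tau> \<le> N" "\<tau> \<noteq> []"
  shows "x \<tau> = 0"
  using assms(3,4)
proof (induction "forest_size \<tau>" arbitrary: \<tau> rule: less_induct)
  case less
  have pos: "0 < forest_size \<sigma>" if "\<sigma> \<noteq> []" for \<sigma> :: "'a forest"
    using that tree_size_pos by (cases \<sigma>) (auto simp: forest_size_def)
  have "(x a - basis [] a) * (x b - basis [] b) = 0" if "(a, b) \<in># coproduct \<tau>" for a b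
  proof (cases "a = [] \<or> b = []")
    case True
    then show ?thesis using assms(1) by (auto simp: basis_def)
  next
    case False
    then have "forest_size a < forest_size \<tau>"
      using forest_size_coproduct[OF that] pos[of b] by simp
    with False less have "x a = 0" by simp
    with False show ?thesis by (simp add: basis_def)
  qed
  then have "0 = (\<Sum>(a, b)\<in>#coproduct \<tau>. (x a - basis [] a) * (x b - basis [] b))"
    by (intro sum_mset.neutral[symmetric]) auto
  also have "\<dots> = (\<Sum>(a, b)\<in>#coproduct \<tau>. x a * x b + basis [] a * basis [] b
      - x a * basis [] b - basis [] a * x b)"
    by (simp add: algebra_simps)
  also have "\<dots> = (x \<star> x) \<tau> + (basis [] \<star> basis []) \<tau> - (x \<star> basis []) \<tau> - (basis [] \<star> x) \<tau>"
    by (simp add: star_def case_prod_unfold sum_mset.distrib sum_mset_subtractf)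
  also have "\<dots> = x \<tau> + basis [] \<tau> - x \<tau> - x \<tau>"
    using idem[OF less.prems(1)] by (simp only: star_basis_Nil_right star_basis_Nil_left)
  finally show ?case
    using less.prems(2) by (simp add: basis_def)
qed

section \<open>Enumeration of the forests with at most two vertices\<close>

lemma forest_size_Nil [simp]: "forest_size [] = 0"
  by (simp add: forest_size_def)

lemma forest_size_Cons [simp]:
  "forest_size (Node i ts # \<tau>) = Suc (forest_size ts + forest_size \<tau>)"
  by (simp add: forest_size_def)

lemma forest_exhaust:
  obtains "\<tau> = []" | i ts \<tau>' where "\<tau> = Node i ts # \<tau>'"
  by (metis neq_Nil_conv tree.exhaust)

lemma forest_size_0_iff [simp]: "forest_size \<tau> = 0 \<longleftrightarrow> \<tau> = []"
  by (cases \<tau> rule: forest_exhaust) auto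

lemma forests_le_1: "forests_le (Suc 0) = insert [] (range (\<lambda>a. [Node a []]))"
proof -
  have "\<tau> \<in> forests_le (Suc 0) \<longleftrightarrow> \<tau> \<in> insert [] (range (\<lambda>a. [Node a []]))" for \<tau> :: "'a forest"
    by (cases \<tau> rule: forest_exhaust) (auto simp: forests_le_def)
  then show ?thesis by blast
qed

lemma forests_le_2:
  "forests_le 2 = insert [] (range (\<lambda>a. [Node a []])) \<union>
     ((\<lambda>(a, b). [Node a [], Node b []]) ` UNIV \<union> (\<lambda>(a, b). [Node a [Node b []]]) ` UNIV)"
proof -
  have 1: "forest_size \<tau> \<le> Suc 0 \<longleftrightarrow> \<tau> = [] \<or> (\<exists>a. \<tau> = [Node a []])" for \<tau> :: "'a forest"
    using forests_le_1 by (auto simp: forests_le_def set_eq_iff)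
  have "forest_size \<tau> \<le> 2 \<longleftrightarrow> \<tau> = [] \<or> (\<exists>a. \<tau> = [Node a []]) \<or>
      (\<exists>a b. \<tau> = [Node a [], Node b []]) \<or> (\<exists>a b. \<tau> = [Node a [Node b []]])" for \<tau> :: "'a forest"
  proof (cases \<tau> rule: forest_exhaust)
    case (2 i ts \<tau>')
    show ?thesis
    proof
      assume "forest_size \<tau> \<le> 2"
      with 2 have s: "forest_size ts + forest_size \<tau>' \<le> Suc 0" by simp
      then have "forest_size ts \<le> Suc 0" "forest_size \<tau>' \<le> Suc 0" by auto
      with s 2 show "\<tau> = [] \<or> (\<exists>a. \<tau> = [Node a []]) \<or>
          (\<exists>a b. \<tau> = [Node a [], Node b []]) \<or> (\<exists>a b. \<tau> = [Node a [Node b []]])"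
        unfolding 1 by auto
    qed (use 2 in auto)
  qed auto
  then show ?thesis by (auto simp: forests_le_def)
qed

lemma sum_forests_le_1:
  "(\<Sum>\<sigma>\<in>forests_le (Suc 0). F \<sigma>) = F [] + (\<Sum>a\<in>(UNIV :: 'd::finite set). F [Node a []])"
  unfolding forests_le_1 by (subst sum.insert) (auto simp: sum.reindex inj_def)

lemma sum_forests_le_2:
  fixes F :: "'d::finite forest \<Rightarrow> 'a::comm_monoid_add"
  shows "(\<Sum>\<sigma>\<in>forests_le 2. F \<sigma>) = F [] + (\<Sum>a\<in>UNIV. F [Node a []])
    + (\<Sum>a\<in>UNIV. \<Sum>b\<in>UNIV. F [Node a [], Node b []] + F [Node a [Node b []]])"
proof -
  have 1: "(\<Sum>\<sigma>\<in>(\<lambda>(a, b). [Node a [], Node b []]) ` UNIV. F \<sigma>) =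
      (\<Sum>a\<in>UNIV. \<Sum>b\<in>UNIV. F [Node a [], Node b []])"
    by (subst sum.reindex) (auto simp: inj_def sum.cartesian_product case_prod_unfold)
  have 2: "(\<Sum>\<sigma>\<in>(\<lambda>(a, b). [Node a [Node b []]]) ` UNIV. F \<sigma>) =
      (\<Sum>a\<in>UNIV. \<Sum>b\<in>UNIV. F [Node a [Node b []]])"
    by (subst sum.reindex) (auto simp: inj_def sum.cartesian_product case_prod_unfold)
  have union: "sum F (A \<union> (B \<union> C)) = sum F A + (sum F B + sum F C)"
    if "finite A" "finite B" "finite C" "A \<inter> B = {}" "A \<inter> C = {}" "B \<inter> C = {}"
    for A B C :: "'d forest set"
    using that by (simp add: sum.union_disjoint Int_Un_distrib)
  have "(\<Sum>\<sigma>\<in>forests_le 2. F \<sigma>) = (\<Sum>\<sigma>\<in>forests_le (Suc 0). F \<sigma>) +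
      ((\<Sum>\<sigma>\<in>(\<lambda>(a, b). [Node a [], Node b []]) ` UNIV. F \<sigma>) +
       (\<Sum>\<sigma>\<in>(\<lambda>(a, b). [Node a [Node b []]]) ` UNIV. F \<sigma>))"
    unfolding forests_le_2 forests_le_1 by (rule union) auto
  then show ?thesis
    unfolding 1 2 sum_forests_le_1 by (simp add: sum.distrib)
qed

text \<open>These are the sums in the definition of a controlled path for \<open>N = 2\<close>,
  written out in coordinates.\<close>

lemma sum_star_basis_1:
  fixes x :: "'d::finite forest \<Rightarrow> real" and Z :: "'d forest \<Rightarrow> 'a::real_vector"
  assumes "x [] = 1"
  shows "(\<Sum>\<sigma>\<in>forests_le (Suc 0). (x \<star> basis []) \<sigma> *\<^sub>R Z \<sigma>) = Z [] + (\<Sum>a\<in>UNIV. x [Node a []] *\<^sub>R Z [Node a []])"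
    and "(\<Sum>\<sigma>\<in>forests_le (Suc 0). (x \<star> basis [Node b []]) \<sigma> *\<^sub>R Z \<sigma>) = Z [Node b []]"
  unfolding sum_forests_le_1
  using assms by (simp_all add: star_basis_Nil_right)
     (simp add: star_def coproduct_bullet basis_def if_distrib[of "\<lambda>x. x *\<^sub>R _"] cong: if_cong)

text \<open>The same sums for \<open>N = 3\<close>. In the second one, the bullet \<open>a\<close>
  can be cut off from \<open>b\<close> either as its left neighbour or as its child, and both
  forests carry the coefficient \<open>x [Node a []]\<close>.\<close>

lemma sum_star_basis_2:
  fixes x :: "'d::finite forest \<Rightarrow> real" and Z :: "'d forest \<Rightarrow> 'a::real_vector"
  assumes "x [] = 1"
  shows "(\<Sum>\<sigma>\<in>forests_le 2. (x \<star> basis []) \<sigma> *\<^sub>R Z \<sigma>) =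
      Z [] + (\<Sum>a\<in>UNIV. x [Node a []] *\<^sub>R Z [Node a []])
      + (\<Sum>a\<in>UNIV. \<Sum>b\<in>UNIV. x [Node a [], Node b []] *\<^sub>R Z [Node a [], Node b []]
          + x [Node a [Node b []]] *\<^sub>R Z [Node a [Node b []]])"
    and "(\<Sum>\<sigma>\<in>forests_le 2. (x \<star> basis [Node b []]) \<sigma> *\<^sub>R Z \<sigma>) =
      Z [Node b []] + (\<Sum>a\<in>UNIV. x [Node a []] *\<^sub>R (Z [Node a [], Node b []] + Z [Node b [Node a []]]))"
    and "(\<Sum>\<sigma>\<in>forests_le 2. (x \<star> basis [Node b [], Node c []]) \<sigma> *\<^sub>R Z \<sigma>) = Z [Node b [], Node c []]"
    and "(\<Sum>\<sigma>\<in>forests_le 2. (x \<star> basis [Node b [Node c []]]) \<sigma> *\<^sub>R Z \<sigma>) = Z [Node b [Node c []]]"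
proof -
  have d2: "(\<Sum>a\<in>UNIV. \<Sum>c\<in>UNIV. (if a = b \<and> c = d then f a c else 0)) = f b d"
    for b d :: 'd and f :: "'d \<Rightarrow> 'd \<Rightarrow> 'a"
  proof -
    have "(\<Sum>a\<in>UNIV. \<Sum>c\<in>UNIV. (if a = b \<and> c = d then f a c else 0)) =
        (\<Sum>a\<in>UNIV. if a = b then f a d else 0)"
      by (intro sum.cong) auto
    then show ?thesis by simp
  qed
  note s = star_def coproduct_bullet coproduct_two_bullets coproduct_ladder basis_def
  show "(\<Sum>\<sigma>\<in>forests_le 2. (x \<star> basis []) \<sigma> *\<^sub>R Z \<sigma>) =
      Z [] + (\<Sum>a\<in>UNIV. x [Node a []] *\<^sub>R Z [Node a []])
      + (\<Sum>a\<in>UNIV. \<Sum>b\<in>UNIV. x [Node a [], Node b []] *\<^sub>R Z [Node a [], Node b []]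
          + x [Node a [Node b []]] *\<^sub>R Z [Node a [Node b []]])"
    using assms by (simp add: sum_forests_le_2 star_basis_Nil_right)
  have "(x \<star> basis [Node b []]) [Node a []] *\<^sub>R Z [Node a []] = (if a = b then Z [Node a []] else 0)"
    "(x \<star> basis [Node b []]) [Node a [], Node c []] *\<^sub>R Z [Node a [], Node c []] =
      (if c = b then x [Node a []] *\<^sub>R Z [Node a [], Node c []] else 0)"
    "(x \<star> basis [Node b []]) [Node a [Node c []]] *\<^sub>R Z [Node a [Node c []]] =
      (if a = b then x [Node c []] *\<^sub>R Z [Node a [Node c []]] else 0)"
    "(x \<star> basis [Node b []]) [] = 0" for a c
    using assms by (auto simp: s)
  then show "(\<Sum>\<sigma>\<in>forests_le 2. (x \<star> basis [Node b []]) \<sigma> *\<^sub>R Z \<sigma>) =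
      Z [Node b []] + (\<Sum>a\<in>UNIV. x [Node a []] *\<^sub>R (Z [Node a [], Node b []] + Z [Node b [Node a []]]))"
    by (simp add: sum_forests_le_2 sum.distrib scaleR_add_right)
       (subst sum.swap, simp)
  have "(x \<star> basis [Node b [], Node c []]) [Node a []] = 0"
    "(x \<star> basis [Node b [], Node c []]) [Node a [], Node d []] *\<^sub>R Z [Node a [], Node d []] =
      (if a = b \<and> d = c then Z [Node a [], Node d []] else 0)"
    "(x \<star> basis [Node b [], Node c []]) [Node a [Node d []]] = 0"
    "(x \<star> basis [Node b [], Node c []]) [] = 0" for a d
    using assms by (auto simp: s)
  then show "(\<Sum>\<sigma>\<in>forests_le 2. (x \<star> basis [Node b [], Node c []]) \<sigma> *\<^sub>R Z \<sigma>) = Z [Node b [], Node c []]"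
    by (simp add: sum_forests_le_2 d2)
  have "(x \<star> basis [Node b [Node c []]]) [Node a []] = 0"
    "(x \<star> basis [Node b [Node c []]]) [Node a [], Node d []] = 0"
    "(x \<star> basis [Node b [Node c []]]) [Node a [Node d []]] *\<^sub>R Z [Node a [Node d []]] =
      (if a = b \<and> d = c then Z [Node a [Node d []]] else 0)"
    "(x \<star> basis [Node b [Node c []]]) [] = 0" for a d
    using assms by (auto simp: s)
  then show "(\<Sum>\<sigma>\<in>forests_le 2. (x \<star> basis [Node b [Node c []]]) \<sigma> *\<^sub>R Z \<sigma>) = Z [Node b [Node c []]]"
    by (simp add: sum_forests_le_2 d2)
qed

section \<open>Rough paths and controlled paths\<close>

lemma rough_path_Nil:
  "planarly_branched_rough_path \<alpha> N T \<X> \<Longrightarrow> s \<in> {0..T} \<Longrightarrow> t \<in> {0..T} \<Longrightarrow> \<X> s t [] = 1"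
  by (simp add: planarly_branched_rough_path_def)

lemma rough_path_Chen:
  "planarly_branched_rough_path \<alpha> N T \<X> \<Longrightarrow> s \<in> {0..T} \<Longrightarrow> u \<in> {0..T} \<Longrightarrow> t \<in> {0..T} \<Longrightarrow>
    forest_size \<tau> \<le> N \<Longrightarrow> (\<X> s u \<star> \<X> u t) \<tau> = \<X> s t \<tau>"
  unfolding planarly_branched_rough_path_def forests_le_def by blast

lemma rough_path_shuffle:
  "planarly_branched_rough_path \<alpha> N T \<X> \<Longrightarrow> s \<in> {0..T} \<Longrightarrow> t \<in> {0..T} \<Longrightarrow>
    forest_size \<sigma> + forest_size \<tau> \<le> N \<Longrightarrow>
    (\<Sum>\<rho>\<in>#shuffle \<sigma> \<tau>. \<X> s t \<rho>) = \<X> s t \<sigma> * \<X> s t \<tau>"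
  unfolding planarly_branched_rough_path_def by blast

text \<open>The regularity condition only sees \<open>s \<noteq> t\<close>. On the diagonal Chen's
  relation makes \<open>\<X> s s\<close> idempotent, hence trivial on nonempty forests, so the bound
  extends there.\<close>

lemma rough_path_order:
  assumes X: "planarly_branched_rough_path \<alpha> N T \<X>" and \<tau>: "forest_size \<tau> \<le> N" "\<tau> \<noteq> []"
  shows "hoelder_order T (real (forest_size \<tau>) * \<alpha>) (\<lambda>s t. \<X> s t \<tau>)"
proof -
  have "bdd_above {\<bar>\<X> s t \<tau>\<bar> / \<bar>t - s\<bar> powr (real (forest_size \<tau>) * \<alpha>) | s t.
          s \<in> {0..T} \<and> t \<in> {0..T} \<and> s \<noteq> t}"
    using X[unfolded planarly_branched_rough_path_def, THEN conjunct2, THEN conjunct2, THEN conjunct2]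
      \<tau>(1) by (simp add: forests_le_def)
  then obtain C where C: "\<And>s t. s \<in> {0..T} \<Longrightarrow> t \<in> {0..T} \<Longrightarrow> s \<noteq> t \<Longrightarrow>
      \<bar>\<X> s t \<tau>\<bar> / \<bar>t - s\<bar> powr (real (forest_size \<tau>) * \<alpha>) \<le> C"
    unfolding bdd_above_def by blast
  show ?thesis
  proof (rule hoelder_orderI)
    fix s t assume st: "s \<in> {0..T}" "t \<in> {0..T}"
    show "norm (\<X> s t \<tau>) \<le> C * \<bar>t - s\<bar> powr (real (forest_size \<tau>) * \<alpha>)"
    proof (cases "s = t")
      case True
      have "\<X> s s \<tau> = 0"
        using rough_path_Nil[OF X st(1) st(1)] rough_path_Chen[OF X st(1) st(1) st(1)] \<tau>
        by (intro star_idempotent_trivial[of "\<X> s s" N])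
      with True show ?thesis by simp
    next
      case False
      with C[OF st] show ?thesis by (simp add: field_simps)
    qed
  qed
qed

lemma controlled_path_iff:
  "controlled_path \<alpha> N T \<X> \<Y> \<longleftrightarrow> (\<forall>t\<in>{0..T}. \<Y> t \<in> truncated (N - 1)) \<and>
     (\<forall>\<tau>\<in>forests_le (N - 1). hoelder_order T ((real N - real (forest_size \<tau>)) * \<alpha>)
        (\<lambda>s t. \<Y> t \<tau> - (\<Sum>\<sigma>\<in>forests_le (N - 1). (\<X> s t \<star> basis \<tau>) \<sigma> *\<^sub>R \<Y> s \<sigma>)))"
  by (simp add: controlled_path_def hoelder_order_def)

lemma bounded_if_increment_order:
  assumes "hoelder_order T p (\<lambda>s t. w t - w s)" "0 \<le> p"
  obtains M where "\<And>t. t \<in> {0..T} \<Longrightarrow> norm (w t) \<le> M"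
proof -
  obtain C where C: "0 \<le> C" "\<And>s t. s \<in> {0..T} \<Longrightarrow> t \<in> {0..T} \<Longrightarrow> norm (w t - w s) \<le> C * \<bar>t - s\<bar> powr p"
    using assms(1) by (rule hoelder_orderE) blast
  have "norm (w t) \<le> norm (w 0) + C * T powr p" if t: "t \<in> {0..T}" for t
  proof -
    have "norm (w t - w 0) \<le> C * \<bar>t\<bar> powr p"
      using C(2)[of 0 t] t by simp
    also have "\<dots> \<le> C * T powr p"
      using t C(1) assms(2) by (intro mult_left_mono powr_mono2) auto
    finally show ?thesis
      using norm_triangle_sub[of "w t" "w 0"] by simp
  qed
  then show ?thesis by (rule that)
qed

section \<open>Composition of a controlled path with a smooth map\<close>

lemma D_zero: "0 \<in> set vs \<Longrightarrow> D G u vs = 0"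
  unfolding D_def
  by (intro sum.neutral) (force simp: in_set_conv_nth)

lemma concat_singletons: "\<forall>x\<in>set xss. length x = 1 \<Longrightarrow> map (\<lambda>x. [x]) (concat xss) = xss"
  by (induction xss) (auto simp: length_Suc_conv)

lemma forest_size_append [simp]: "forest_size (\<sigma> @ \<tau>) = forest_size \<sigma> + forest_size \<tau>"
  by (simp add: forest_size_def)

lemma forest_size_concat: "\<sigma> \<in> set \<tau>s \<Longrightarrow> forest_size \<sigma> \<le> forest_size (concat \<tau>s)"
  by (induction \<tau>s) auto

lemma length_le_forest_size: "length \<tau> \<le> forest_size \<tau>"
proof (induction \<tau>)
  case (Cons t \<tau>)
  then show ?case by (cases t) auto
qed simp

text \<open>All factorizations of \<open>\<tau>\<close> except the one into single trees contribute zero.\<close>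

lemma compose_controlled_eq_D:
  fixes \<Y> :: "real \<Rightarrow> 'd::finite forest \<Rightarrow> real ^ 'n"
  assumes "\<tau> \<in> forests_le (N - 1)"
    and zero: "\<And>\<sigma>. \<sigma> \<in> forests_le (N - 1) \<Longrightarrow> 2 \<le> length \<sigma> \<Longrightarrow> \<Y> t \<sigma> = 0"
  shows "compose_controlled N G \<Y> t \<tau> = D G (\<Y> t []) (map (\<lambda>x. \<Y> t [x]) \<tau>)"
proof (cases "\<tau> = []")
  case True
  then show ?thesis by (simp add: compose_controlled_def)
next
  case False
  define S where "S m = {\<tau>s. length \<tau>s = m \<and> [] \<notin> set \<tau>s \<and> concat \<tau>s = \<tau>}" for m
  let ?f = "\<lambda>\<tau>s. D G (\<Y> t []) (map (\<Y> t) \<tau>s)"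
  let ?\<tau>s = "map (\<lambda>x. [x]) \<tau>"
  have small: "\<sigma> \<in> forests_le (N - 1)" if "\<tau>s \<in> S m" "\<sigma> \<in> set \<tau>s" for m \<tau>s \<sigma>
    using that assms(1) forest_size_concat[OF that(2)] by (auto simp: S_def forests_le_def)
  have f0: "?f \<tau>s = 0" if in_S: "\<tau>s \<in> S m" and ne: "\<tau>s \<noteq> ?\<tau>s" for m \<tau>s
  proof -
    have "\<not> (\<forall>\<sigma>\<in>set \<tau>s. length \<sigma> = 1)"
      using in_S ne concat_singletons[of \<tau>s] unfolding S_def by auto
    then obtain \<sigma> where \<sigma>: "\<sigma> \<in> set \<tau>s" "length \<sigma> \<noteq> 1" by blast
    moreover have "\<sigma> \<noteq> []" using in_S \<sigma>(1) by (auto simp: S_def)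
    ultimately have "2 \<le> length \<sigma>"
      by (metis One_nat_def length_0_conv less_2_cases not_less)
    then show ?thesis
      using \<sigma>(1) zero[OF small[OF in_S \<sigma>(1)]] by (intro D_zero) (auto simp: image_iff)
  qed
  have "sum ?f (S m) = (if m = length \<tau> then ?f ?\<tau>s else 0)" for m
  proof (cases "m = length \<tau>")
    case True
    have "finite (S m)"
      using small finite_forests_trees_le
      by (intro finite_subset[OF _ finite_lists_length_eq[of "forests_le (N - 1)" m]])
         (auto simp: S_def)
    moreover have "?\<tau>s \<in> S m" using True by (auto simp: S_def)
    ultimately have "sum ?f (S m) = sum ?f {?\<tau>s}"
      using f0 by (intro sum.mono_neutral_right) auto
    with True show ?thesis by simp
  next
    case False
    then have "?\<tau>s \<notin> S m" by (simp add: S_def)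
    then show ?thesis using False f0 by (intro sum.neutral[THEN trans]) auto
  qed
  \<comment> \<open>The surviving factorization has \<open>length \<tau>\<close> factors, so this
    number has to lie in the range of the outer sum.\<close>
  moreover have "length \<tau> \<in> {1..N - 1}"
    using False assms(1) length_le_forest_size[of \<tau>] by (cases \<tau>) (auto simp: forests_le_def)
  ultimately have "(\<Sum>m = 1..N - 1. sum ?f (S m)) = ?f ?\<tau>s"
    by simp
  with False assms(1) show ?thesis
    by (simp add: compose_controlled_def S_def o_def)
qed

lemma compose_controlled_truncated: "compose_controlled N G \<Y> t \<in> truncated (N - 1)"
  by (simp add: truncated_def compose_controlled_def forests_le_def)

text \<open>The forests involved are \<open>[]\<close> and single bullets, with remainders of order
  2\<alpha> and \<alpha>; they are handled by \<open>composition_order_2\<close> and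
  \<open>composition_deriv_order_1\<close>.\<close>

lemma compose_controlled_controlled_2:
  fixes \<Y> :: "real \<Rightarrow> 'd::finite forest \<Rightarrow> real ^ 'n"
  assumes "0 < \<alpha>" and X: "planarly_branched_rough_path \<alpha> 2 T \<X>"
    and Y: "controlled_path \<alpha> 2 T \<X> \<Y>" and G: "smooth G"
    and tree_like: "\<And>t \<tau>. t \<in> {0..T} \<Longrightarrow> \<tau> \<in> forests_le (2 - 1) \<Longrightarrow> 2 \<le> length \<tau> \<Longrightarrow> \<Y> t \<tau> = 0"
  shows "controlled_path \<alpha> 2 T \<X> (compose_controlled 2 G \<Y>)"
proof -
  define y where "y t = \<Y> t []" for t
  define w where "w a t = \<Y> t [Node a []]" for a t
  define L where "L s t = (\<Sum>a\<in>UNIV. \<X> s t [Node a []] *\<^sub>R w a s)" for s t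
  note X_Nil = rough_path_Nil[OF X]
  have c: "hoelder_order T ((2 - real (forest_size \<tau>)) * \<alpha>)
      (\<lambda>s t. \<Y> t \<tau> - (\<Sum>\<sigma>\<in>forests_le (Suc 0). (\<X> s t \<star> basis \<tau>) \<sigma> *\<^sub>R \<Y> s \<sigma>))"
    if "\<tau> \<in> forests_le (Suc 0)" for \<tau>
    using Y that by (simp add: controlled_path_iff)
  have mem: "[] \<in> forests_le (Suc 0)" "[Node a []] \<in> forests_le (Suc 0)" for a b :: 'd
    by (simp_all add: forests_le_def)
  have c0: "hoelder_order T (2 * \<alpha>) (\<lambda>s t. y t - y s - L s t)"
    by (rule hoelder_order_cong[OF _ c[OF mem(1), simplified]])
       (simp_all add: sum_star_basis_1 X_Nil y_def w_def L_def)
  have c1: "hoelder_order T \<alpha> (\<lambda>s t. w a t - w a s)" for a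
    by (rule hoelder_order_cong[OF _ c[OF mem(2)[of a], simplified]])
       (simp_all add: sum_star_basis_1 X_Nil w_def)
  have "\<exists>M. \<forall>t\<in>{0..T}. norm (w a t) \<le> M" for a
    using bounded_if_increment_order[OF c1] assms(1) by (metis less_imp_le)
  then obtain M where M: "\<And>a t. t \<in> {0..T} \<Longrightarrow> norm (w a t) \<le> M a" by metis
  have L: "hoelder_order T \<alpha> L"
    unfolding L_def
    using rough_path_order[OF X, of "[Node _ []]"] M
    by (intro hoelder_order_sum hoelder_order_scaleR_bounded) auto
  have "hoelder_order T \<alpha> (\<lambda>s t. (y t - y s - L s t) + L s t)"
    using assms(1) by (intro hoelder_order_add L hoelder_order_mono[OF c0]) auto
  then have incr: "hoelder_order T \<alpha> (\<lambda>s t. y t - y s)" by simp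
  obtain R where "\<And>t. t \<in> {0..T} \<Longrightarrow> norm (y t) \<le> R"
    using bounded_if_increment_order[OF incr] assms(1) by (metis less_imp_le)
  then have R: "\<And>t. t \<in> {0..T} \<Longrightarrow> y t \<in> cball 0 R" by simp
  let ?Z = "compose_controlled 2 G \<Y>"
  have Z: "?Z t \<tau> = D G (y t) (map (\<lambda>x. \<Y> t [x]) \<tau>)" if "t \<in> {0..T}" "\<tau> \<in> forests_le (Suc 0)" for t \<tau>
    using that tree_like unfolding y_def by (intro compose_controlled_eq_D) auto
  have Z0: "?Z t [] = G (y t)" and Z1: "?Z t [Node a []] = D G (y t) [w a t]" if "t \<in> {0..T}" for t a
    using Z[OF that, of "[]"] Z[OF that, of "[Node a []]"] by (simp_all add: forests_le_1 w_def)
  note lin = linear_sum[OF linear_D_Cons[OF G]] linear_scale[OF linear_D_Cons[OF G]]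
  have "hoelder_order T (2 * \<alpha>)
      (\<lambda>s t. ?Z t [] - (\<Sum>\<sigma>\<in>forests_le (Suc 0). (\<X> s t \<star> basis []) \<sigma> *\<^sub>R ?Z s \<sigma>))"
    by (rule hoelder_order_cong[OF _ composition_order_2[OF G R less_imp_le[OF assms(1)] L c0]])
       (simp_all add: sum_star_basis_1 X_Nil Z0 Z1 L_def lin)
  moreover have "hoelder_order T \<alpha>
      (\<lambda>s t. ?Z t [Node a []] - (\<Sum>\<sigma>\<in>forests_le (Suc 0). (\<X> s t \<star> basis [Node a []]) \<sigma> *\<^sub>R ?Z s \<sigma>))" for a
    by (rule hoelder_order_cong[OF _ composition_deriv_order_1[OF G R incr c1 M]])
       (simp_all add: sum_star_basis_1 X_Nil Z1)
  ultimately show ?thesis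
    unfolding controlled_path_iff
    by (auto simp: forests_le_1 compose_controlled_truncated[where N = 2, simplified])
qed

lemma compose_controlled_controlled_3:
  fixes \<Y> :: "real \<Rightarrow> 'd::finite forest \<Rightarrow> real ^ 'n"
  assumes "0 < \<alpha>" and X: "planarly_branched_rough_path \<alpha> 3 T \<X>"
    and Y: "controlled_path \<alpha> 3 T \<X> \<Y>" and G: "smooth G"
    and tree_like: "\<And>t \<tau>. t \<in> {0..T} \<Longrightarrow> \<tau> \<in> forests_le (3 - 1) \<Longrightarrow> 2 \<le> length \<tau> \<Longrightarrow> \<Y> t \<tau> = 0"
  shows "controlled_path \<alpha> 3 T \<X> (compose_controlled 3 G \<Y>)"
proof -
  define y where "y t = \<Y> t []" for t
  define w where "w a t = \<Y> t [Node a []]" for a t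
  define v where "v a b t = \<Y> t [Node a [Node b []]]" for a b t
  define L where "L s t = (\<Sum>a\<in>UNIV. \<X> s t [Node a []] *\<^sub>R w a s)" for s t
  define Q where "Q s t = (\<Sum>a\<in>UNIV. \<Sum>b\<in>UNIV. \<X> s t [Node a [Node b []]] *\<^sub>R v a b s)" for s t
  define K where "K b s t = (\<Sum>a\<in>UNIV. \<X> s t [Node a []] *\<^sub>R v b a s)" for b s t
  note X_Nil = rough_path_Nil[OF X]
  \<comment> \<open>Hence only ladders enter \<open>Q\<close> and \<open>K\<close>, although the
    composed path has values on pairs of bullets.\<close>
  have two_bullets: "\<Y> t [Node a [], Node b []] = 0" if "t \<in> {0..T}" for t a b
    using that tree_like by (simp add: forests_le_def)
  have c: "hoelder_order T ((3 - real (forest_size \<tau>)) * \<alpha>)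
      (\<lambda>s t. \<Y> t \<tau> - (\<Sum>\<sigma>\<in>forests_le 2. (\<X> s t \<star> basis \<tau>) \<sigma> *\<^sub>R \<Y> s \<sigma>))"
    if "\<tau> \<in> forests_le 2" for \<tau>
    using Y that by (simp add: controlled_path_iff)
  have mem: "[] \<in> forests_le 2" "[Node a []] \<in> forests_le 2" "[Node a [Node b []]] \<in> forests_le 2" for a b :: 'd
    by (simp_all add: forests_le_def)
  have c0: "hoelder_order T (3 * \<alpha>) (\<lambda>s t. y t - y s - L s t - Q s t)"
    by (rule hoelder_order_cong[OF _ c[OF mem(1), simplified]])
       (simp_all add: sum_star_basis_2 X_Nil two_bullets y_def w_def v_def L_def Q_def)
  have c1: "hoelder_order T (2 * \<alpha>) (\<lambda>s t. w b t - w b s - K b s t)" for b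
    by (rule hoelder_order_cong[OF _ c[OF mem(2)[of b], simplified]])
       (simp_all add: sum_star_basis_2 X_Nil two_bullets w_def v_def K_def)
  have c2: "hoelder_order T \<alpha> (\<lambda>s t. v a b t - v a b s)" for a b
    by (rule hoelder_order_cong[OF _ c[OF mem(3)[of a b], simplified]])
       (simp_all add: sum_star_basis_2 X_Nil v_def)
  \<comment> \<open>Boundedness is obtained from the largest trees downwards: bounded
    \<open>v\<close> gives \<open>K\<close> order \<alpha> and \<open>Q\<close> order 2\<alpha>;
    then \<open>w\<close> is bounded, which gives \<open>L\<close> order \<alpha>; and finally
    \<open>y\<close> is bounded.\<close>
  have "\<exists>M. \<forall>t\<in>{0..T}. norm (v a b t) \<le> M" for a b
    using bounded_if_increment_order[OF c2] assms(1) by (metis less_imp_le)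
  then obtain Mv where Mv: "\<And>a b t. t \<in> {0..T} \<Longrightarrow> norm (v a b t) \<le> Mv a b" by metis
  have bullet: "hoelder_order T \<alpha> (\<lambda>s t. \<X> s t [Node a []])" for a
    using rough_path_order[OF X, of "[Node a []]"] by simp
  have ladder: "hoelder_order T (2 * \<alpha>) (\<lambda>s t. \<X> s t [Node a [Node b []]])" for a b
    using rough_path_order[OF X, of "[Node a [Node b []]]"] by simp
  have K: "hoelder_order T \<alpha> (K b)" for b
    unfolding K_def using Mv by (intro hoelder_order_sum hoelder_order_scaleR_bounded bullet)
  have "hoelder_order T \<alpha> (\<lambda>s t. (w b t - w b s - K b s t) + K b s t)" for b
    using assms(1) by (intro hoelder_order_add K hoelder_order_mono[OF c1]) auto
  then have w: "hoelder_order T \<alpha> (\<lambda>s t. w b t - w b s)" for b by simp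
  have "\<exists>M. \<forall>t\<in>{0..T}. norm (w a t) \<le> M" for a
    using bounded_if_increment_order[OF w] assms(1) by (metis less_imp_le)
  then obtain Mw where Mw: "\<And>a t. t \<in> {0..T} \<Longrightarrow> norm (w a t) \<le> Mw a" by metis
  have L: "hoelder_order T \<alpha> L"
    unfolding L_def using Mw by (intro hoelder_order_sum hoelder_order_scaleR_bounded bullet)
  have Q: "hoelder_order T (2 * \<alpha>) Q"
    unfolding Q_def using Mv by (intro hoelder_order_sum hoelder_order_scaleR_bounded ladder)
  have "hoelder_order T (2 * \<alpha>) (\<lambda>s t. (y t - y s - L s t - Q s t) + Q s t)"
    using assms(1) by (intro hoelder_order_add Q hoelder_order_mono[OF c0]) auto
  then have c0': "hoelder_order T (2 * \<alpha>) (\<lambda>s t. y t - y s - L s t)" by simp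
  have "hoelder_order T \<alpha> (\<lambda>s t. (y t - y s - L s t) + L s t)"
    using assms(1) by (intro hoelder_order_add L hoelder_order_mono[OF c0']) auto
  then have incr: "hoelder_order T \<alpha> (\<lambda>s t. y t - y s)" by simp
  obtain R where "\<And>t. t \<in> {0..T} \<Longrightarrow> norm (y t) \<le> R"
    using bounded_if_increment_order[OF incr] assms(1) by (metis less_imp_le)
  then have R: "\<And>t. t \<in> {0..T} \<Longrightarrow> y t \<in> cball 0 R" by simp
  let ?Z = "compose_controlled 3 G \<Y>"
  have Z: "?Z t \<tau> = D G (y t) (map (\<lambda>x. \<Y> t [x]) \<tau>)" if "t \<in> {0..T}" "\<tau> \<in> forests_le 2" for t \<tau>
    using that tree_like unfolding y_def by (intro compose_controlled_eq_D) auto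
  have Z0: "?Z t [] = G (y t)" and Z1: "?Z t [Node a []] = D G (y t) [w a t]"
    and Z2: "?Z t [Node a [], Node b []] = D G (y t) [w a t, w b t]"
    and Z3: "?Z t [Node a [Node b []]] = D G (y t) [v a b t]" if "t \<in> {0..T}" for t a b
    using Z[OF that] by (simp_all add: forests_le_def w_def v_def)
  note lin = linear_sum[OF linear_D_Cons[OF G]] linear_scale[OF linear_D_Cons[OF G]]
  have DLL: "(1 / 2) *\<^sub>R D G (y s) [L s t, L s t] =
      (\<Sum>a\<in>UNIV. \<Sum>b\<in>UNIV. \<X> s t [Node a [], Node b []] *\<^sub>R D G (y s) [w a s, w b s])"
    (is "_ = ?S") if st: "s \<in> {0..T}" "t \<in> {0..T}" for s t
  proof -
    have prod: "\<X> s t [Node a []] * \<X> s t [Node b []] =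
        \<X> s t [Node a [], Node b []] + \<X> s t [Node b [], Node a []]" for a b
      using rough_path_shuffle[OF X st, of "[Node a []]" "[Node b []]"] by simp
    have "D G (y s) [L s t, L s t] = (\<Sum>a\<in>UNIV. \<Sum>b\<in>UNIV.
        (\<X> s t [Node a []] * \<X> s t [Node b []]) *\<^sub>R D G (y s) [w a s, w b s])"
      unfolding L_def
      by (simp add: lin linear_sum[OF linear_D_snoc[of G _ "[_]", simplified]]
          linear_scale[OF linear_D_snoc[of G _ "[_]", simplified]] scaleR_right.sum)
        (simp add: D_pair_commute[OF G])
    also have "\<dots> = ?S + (\<Sum>a\<in>UNIV. \<Sum>b\<in>UNIV. \<X> s t [Node b [], Node a []] *\<^sub>R D G (y s) [w a s, w b s])"
      unfolding prod by (simp add: scaleR_add_left sum.distrib)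
    \<comment> \<open>Renaming the indices makes the two sums equal, and their factor 2 cancels the
      1/2 of Taylor's formula.\<close>
    also have "(\<Sum>a\<in>UNIV. \<Sum>b\<in>UNIV. \<X> s t [Node b [], Node a []] *\<^sub>R D G (y s) [w a s, w b s]) = ?S"
      by (subst sum.swap) (simp add: D_pair_commute[OF G])
    finally show ?thesis by (simp flip: scaleR_2)
  qed
  have "hoelder_order T (3 * \<alpha>)
      (\<lambda>s t. ?Z t [] - (\<Sum>\<sigma>\<in>forests_le 2. (\<X> s t \<star> basis []) \<sigma> *\<^sub>R ?Z s \<sigma>))"
    by (rule hoelder_order_cong[OF _ composition_order_3[OF G R less_imp_le[OF assms(1)] L Q c0]])
       \<comment> \<open>\<open>DLL\<close> is rewritten first, because its left-hand side only
         matches while \<open>L\<close> is still folded.\<close>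
       (simp_all add: DLL, simp_all add: sum_star_basis_2 X_Nil Z0 Z1 Z2 Z3 L_def Q_def lin sum.distrib)
  moreover have "hoelder_order T (2 * \<alpha>)
      (\<lambda>s t. ?Z t [Node a []] - (\<Sum>\<sigma>\<in>forests_le 2. (\<X> s t \<star> basis [Node a []]) \<sigma> *\<^sub>R ?Z s \<sigma>))" for a
    by (rule hoelder_order_cong[OF _ composition_deriv_order_2[OF G R less_imp_le[OF assms(1)] L c0' K[of a] c1[of a] Mw]])
       (simp_all add: sum_star_basis_2 X_Nil Z1 Z2 Z3 L_def K_def lin sum.distrib scaleR_add_right)
  moreover have "hoelder_order T \<alpha> (\<lambda>s t. ?Z t [Node a [], Node b []]
      - (\<Sum>\<sigma>\<in>forests_le 2. (\<X> s t \<star> basis [Node a [], Node b []]) \<sigma> *\<^sub>R ?Z s \<sigma>))" for a b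
    by (rule hoelder_order_cong[OF _ composition_deriv2_order_1[OF G R incr w w, of a "max (Mw a) (Mw b)" b]])
       (simp_all add: sum_star_basis_2 X_Nil Z2 Mw le_max_iff_disj)
  moreover have "hoelder_order T \<alpha> (\<lambda>s t. ?Z t [Node a [Node b []]]
      - (\<Sum>\<sigma>\<in>forests_le 2. (\<X> s t \<star> basis [Node a [Node b []]]) \<sigma> *\<^sub>R ?Z s \<sigma>))" for a b
    by (rule hoelder_order_cong[OF _ composition_deriv_order_1[OF G R incr c2 Mv]])
       (simp_all add: sum_star_basis_2 X_Nil Z3)
  ultimately show ?thesis
    unfolding controlled_path_iff
    by (auto simp: forests_le_2 compose_controlled_truncated[where N = 3, simplified])
qed

section \<open>Partitions and sewing\<close>

text \<open>The defining family is directed by taking the smaller mesh bound, so an eventual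
  property already holds on one of its members.\<close>

lemma eventually_mesh_filter:
  "eventually P (mesh_filter s t) \<longleftrightarrow>
     (\<exists>\<delta>>0. \<forall>p. is_partition s t p \<longrightarrow> (\<forall>(u, v)\<in>set (intervals p). v - u < \<delta>) \<longrightarrow> P p)"
  unfolding mesh_filter_def
proof (subst eventually_INF_base)
  fix a b :: real
  assume "a \<in> {0<..}" "b \<in> {0<..}"
  then show "\<exists>x\<in>{0<..}. principal {p. is_partition s t p \<and> (\<forall>(u, v)\<in>set (intervals p). v - u < x)}
      \<le> inf (principal {p. is_partition s t p \<and> (\<forall>(u, v)\<in>set (intervals p). v - u < a)})
         (principal {p. is_partition s t p \<and> (\<forall>(u, v)\<in>set (intervals p). v - u < b)})"
    by (intro bexI[of _ "min a b"]) auto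
qed (auto simp: eventually_principal)

text \<open>The common endpoint stays listed once, as the last point of \<open>p\<close>, so
  dropping it from \<open>q\<close> loses no interval.\<close>

lemma intervals_append:
  assumes "p \<noteq> []" "q \<noteq> []" "last p = hd q"
  shows "intervals (p @ tl q) = intervals p @ intervals q"
  using assms(1,3)
proof (induction p rule: list_nonempty_induct)
  case (single x)
  then show ?case using assms(2) by (cases q) (auto simp: intervals_def)
next
  case (cons x xs)
  then show ?case by (cases xs) (auto simp: intervals_def)
qed

lemma is_partition_append:
  assumes "is_partition s u p" "is_partition u t q"
  shows "is_partition s t (p @ tl q)"
proof -
  have le: "x \<le> last p" if "x \<in> set p" "sorted_wrt (<) p" for x :: real and p
    using that by (induction p) (auto intro: less_imp_le)
  obtain q' where "q = u # q'"
    using assms(2) by (cases q) (auto simp: is_partition_def)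
  then show ?thesis
    using assms le by (fastforce simp: is_partition_def sorted_wrt_append)
qed

text \<open>Bisection: the constant \<open>C = K / (1 - 2 powr (1 - \<theta>))\<close> is the fixed point of
  \<open>C \<mapsto> K + 2 powr (1 - \<theta>) * C\<close>.\<close>

lemma dyadic_partition:
  fixes A :: "real \<Rightarrow> real \<Rightarrow> 'a::real_normed_vector"
  assumes "1 < \<theta>" and "a \<le> s" "s < t" "t \<le> b"
    and almost_additive: "\<And>s u t. a \<le> s \<Longrightarrow> s \<le> u \<Longrightarrow> u \<le> t \<Longrightarrow> t \<le> b \<Longrightarrow>
      norm (A s t - A s u - A u t) \<le> K * (t - s) powr \<theta>"
  shows "\<exists>p. is_partition s t p \<and> (\<forall>(u, v)\<in>set (intervals p). v - u \<le> (t - s) / 2 ^ n) \<and>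
    norm ((\<Sum>(u, v)\<leftarrow>intervals p. A u v) - A s t) \<le> K / (1 - 2 powr (1 - \<theta>)) * (t - s) powr \<theta>"
  using assms(2-4)
proof (induction n arbitrary: s t)
  case 0
  \<comment> \<open>The sign of \<open>K\<close> is not assumed; the hypothesis at
    \<open>u = s\<close> provides it in this form.\<close>
  have "0 \<le> K * (t - s) powr \<theta>"
    using almost_additive[of s s t] 0 norm_ge_zero order_trans by (metis order.refl less_imp_le)
  moreover have "2 powr (1 - \<theta>) < 1"
    using assms(1) powr_less_cancel_iff[of 2 "1 - \<theta>" 0] by simp
  ultimately have "0 \<le> K / (1 - 2 powr (1 - \<theta>)) * (t - s) powr \<theta>"
    by simp
  with 0 show ?case
    by (intro exI[of _ "[s, t]"]) (auto simp: is_partition_def intervals_def)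
next
  case (Suc n)
  define m where "m = (s + t) / 2"
  define C where "C = K / (1 - 2 powr (1 - \<theta>))"
  let ?S = "\<lambda>p. \<Sum>(u, v)\<leftarrow>intervals p. A u v"
  have m: "s < m" "m < t" "m - s = (t - s) / 2" "t - m = (t - s) / 2"
    using Suc.prems by (auto simp: m_def field_simps)
  obtain p where p: "is_partition s m p" "\<forall>(u, v)\<in>set (intervals p). v - u \<le> (m - s) / 2 ^ n"
      "norm (?S p - A s m) \<le> C * (m - s) powr \<theta>"
    using Suc.IH[of s m] Suc.prems m by (auto simp: C_def)
  obtain q where q: "is_partition m t q" "\<forall>(u, v)\<in>set (intervals q). v - u \<le> (t - m) / 2 ^ n"
      "norm (?S q - A m t) \<le> C * (t - m) powr \<theta>"
    using Suc.IH[of m t] Suc.prems m by (auto simp: C_def)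
  have I: "intervals (p @ tl q) = intervals p @ intervals q"
    using p(1) q(1) by (intro intervals_append) (auto simp: is_partition_def)
  have "2 powr (1 - \<theta>) < 1"
    using assms(1) powr_less_cancel_iff[of 2 "1 - \<theta>" 0] by simp
  with assms(1) have "C * (1 - 2 powr (1 - \<theta>)) = K"
    by (simp add: C_def)
  then have fix_pt: "2 powr (1 - \<theta>) * C + K = C"
    by (simp add: algebra_simps)
  have "?S (p @ tl q) - A s t = (?S p - A s m) + (?S q - A m t) - (A s t - A s m - A m t)"
    by (simp add: I)
  also have "norm \<dots> \<le> norm (?S p - A s m) + norm (?S q - A m t) + norm (A s t - A s m - A m t)"
    by (intro order_trans[OF norm_triangle_ineq4] add_mono norm_triangle_ineq order_refl)
  also have "\<dots> \<le> C * (m - s) powr \<theta> + C * (t - m) powr \<theta> + K * (t - s) powr \<theta>"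
    using Suc.prems m by (intro add_mono p(3) q(3) almost_additive) auto
  \<comment> \<open>Each half contributes \<open>C * ((t - s) / 2) powr \<theta>\<close>, and
    together they give the factor \<open>2 powr (1 - \<theta>)\<close>.\<close>
  also have "\<dots> = (2 powr (1 - \<theta>) * C + K) * (t - s) powr \<theta>"
    using Suc.prems unfolding m(3,4)
    by (simp add: powr_divide powr_diff field_simps)
  finally have "norm (?S (p @ tl q) - A s t) \<le> C * (t - s) powr \<theta>"
    by (simp add: fix_pt)
  with p q I m show ?case
    by (intro exI[of _ "p @ tl q"]) (auto simp: C_def intro!: is_partition_append)
qed

lemma dyadic_mesh: "0 < \<delta> \<Longrightarrow> \<exists>n. x / 2 ^ n < (\<delta>::real)"
proof -
  assume "0 < \<delta>"
  then obtain n where "x / \<delta> < 2 ^ n"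
    using real_arch_pow[of 2 "x / \<delta>"] by auto
  with \<open>0 < \<delta>\<close> show ?thesis by (auto simp: field_simps)
qed

text \<open>The limits are over partitions starting at \<open>a\<close>, so a fine partition
  \<open>p\<close> of \<open>[a, s]\<close> is glued to a dyadic partition \<open>q\<close> of
  \<open>[s, t]\<close>. The glued sum is close to \<open>J\<close> and the sum over
  \<open>p\<close> to \<open>I\<close>; their difference is the sum over \<open>q\<close>, which
  \<open>dyadic_partition\<close> compares with \<open>A s t\<close> uniformly in the mesh.\<close>

lemma sewing_increment:
  fixes A :: "real \<Rightarrow> real \<Rightarrow> 'a::real_normed_vector"
  assumes "1 < \<theta>" and "a \<le> s" "s < t" "t \<le> b"
    and almost_additive: "\<And>s u t. a \<le> s \<Longrightarrow> s \<le> u \<Longrightarrow> u \<le> t \<Longrightarrow> t \<le> b \<Longrightarrow>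
      norm (A s t - A s u - A u t) \<le> K * (t - s) powr \<theta>"
    and I: "((\<lambda>p. \<Sum>(u, v)\<leftarrow>intervals p. A u v) \<longlongrightarrow> I) (mesh_filter a s)"
    and J: "((\<lambda>p. \<Sum>(u, v)\<leftarrow>intervals p. A u v) \<longlongrightarrow> J) (mesh_filter a t)"
  shows "norm (J - I - A s t) \<le> K / (1 - 2 powr (1 - \<theta>)) * (t - s) powr \<theta>"
proof (rule field_le_epsilon)
  fix e :: real
  assume "0 < e"
  let ?S = "\<lambda>p. \<Sum>(u, v)\<leftarrow>intervals p. A u v"
  let ?C = "K / (1 - 2 powr (1 - \<theta>)) * (t - s) powr \<theta>"
  have "\<forall>\<^sub>F p in mesh_filter a s. dist (?S p) I < e / 2" "\<forall>\<^sub>F p in mesh_filter a t. dist (?S p) J < e / 2"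
    using tendstoD[OF I, of "e / 2"] tendstoD[OF J, of "e / 2"] \<open>0 < e\<close> by simp_all
  then obtain d1 d2 where d: "0 < d1" "0 < d2"
    "\<And>p. is_partition a s p \<Longrightarrow> (\<forall>(u, v)\<in>set (intervals p). v - u < d1) \<Longrightarrow> dist (?S p) I < e / 2"
    "\<And>p. is_partition a t p \<Longrightarrow> (\<forall>(u, v)\<in>set (intervals p). v - u < d2) \<Longrightarrow> dist (?S p) J < e / 2"
    unfolding eventually_mesh_filter by metis
  define d where "d = min d1 d2"
  have "0 < d" using d by (simp add: d_def)
  \<comment> \<open>Bisection needs an interval of positive length; for \<open>a = s\<close> the
    partition \<open>[s]\<close>, which has no intervals, serves instead.\<close>
  obtain p where p: "is_partition a s p" "\<forall>(u, v)\<in>set (intervals p). v - u < d"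
  proof (cases "a = s")
    case True
    then show ?thesis
      by (intro that[of "[s]"]) (auto simp: is_partition_def intervals_def)
  next
    case False
    obtain n where "(s - a) / 2 ^ n < d" using dyadic_mesh[OF \<open>0 < d\<close>] by blast
    moreover have "\<exists>p. is_partition a s p \<and> (\<forall>(u, v)\<in>set (intervals p). v - u \<le> (s - a) / 2 ^ n) \<and>
        norm (?S p - A a s) \<le> K / (1 - 2 powr (1 - \<theta>)) * (s - a) powr \<theta>"
      using False assms(2-4) by (intro dyadic_partition[where b = b] assms(1) almost_additive) auto
    ultimately show ?thesis using that by fastforce
  qed
  obtain n where "(t - s) / 2 ^ n < d" using dyadic_mesh[OF \<open>0 < d\<close>] by blast
  moreover obtain q where q: "is_partition s t q"
      "\<forall>(u, v)\<in>set (intervals q). v - u \<le> (t - s) / 2 ^ n" "norm (?S q - A s t) \<le> ?C"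
    using dyadic_partition[OF assms(1-4) almost_additive] by blast
  ultimately have q': "\<forall>(u, v)\<in>set (intervals q). v - u < d" by force
  have IV: "intervals (p @ tl q) = intervals p @ intervals q"
    using p(1) q(1) by (intro intervals_append) (auto simp: is_partition_def)
  have "dist (?S p) I < e / 2"
    using p by (intro d(3)) (auto simp: d_def)
  moreover have "dist (?S (p @ tl q)) J < e / 2"
    using p q' is_partition_append[OF p(1) q(1)] by (intro d(4)) (auto simp: d_def IV)
  moreover have "J - I - A s t = (?S p - I) - (?S (p @ tl q) - J) + (?S q - A s t)"
    by (simp add: IV)
  then have "norm (J - I - A s t) \<le> norm (?S p - I) + norm (?S (p @ tl q) - J) + norm (?S q - A s t)"
    by (metis (no_types, lifting) norm_triangle_ineq norm_triangle_ineq4 add_mono_thms_linordered_semiring(3) order_trans)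
  ultimately show "norm (J - I - A s t) \<le> ?C + e"
    using q(3) by (simp add: dist_norm)
qed

section \<open>The rough integral and the expansion\<close>

lemma sum_mset_basis_expansion:
  assumes "finite S" "\<And>a c. (a, c) \<in># P \<Longrightarrow> c \<in> S"
  shows "(\<Sum>(a, c)\<in>#P. x a * f c) = (\<Sum>b\<in>S. (\<Sum>(a, c)\<in>#P. x a * basis b c) * f b)"
  using assms(2)
proof (induction P)
  case (add p P)
  obtain a c where p: "p = (a, c)" by fastforce
  have "(\<Sum>b\<in>S. x a * basis b c * f b) = (\<Sum>b\<in>S. if b = c then x a * f b else 0)"
    by (intro sum.cong) (auto simp: basis_def)
  also have "\<dots> = x a * f c"
    using assms(1) add.prems[of a c] p by simp
  finally have "(\<Sum>b\<in>S. x a * basis b c * f b) = x a * f c" .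
  moreover have "(\<Sum>(a, c)\<in>#P. x a * f c) = (\<Sum>b\<in>S. (\<Sum>(a, c)\<in>#P. x a * basis b c) * f b)"
    using add.prems by (intro add.IH) auto
  ultimately show ?case
    by (simp add: p distrib_right sum.distrib)
qed simp

text \<open>Linearity in the second factor. The finite sum suffices since, by the grading, the right
  factors of the coproduct of \<open>\<tau>\<close> have at most \<open>m\<close> vertices.\<close>

lemma star_basis_expansion:
  fixes x f :: "'d::finite forest \<Rightarrow> real"
  assumes "\<tau> \<in> forests_le m"
  shows "(x \<star> f) \<tau> = (\<Sum>b\<in>forests_le m. (x \<star> basis b) \<tau> * f b)"
  unfolding star_def
proof (rule sum_mset_basis_expansion)
  show "c \<in> forests_le m" if "(a, c) \<in># coproduct \<tau>" for a c
    using assms forest_size_coproduct[OF that] by (simp add: forests_le_def)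
qed (use finite_forests_trees_le in blast)

lemma local_approximation_defect:
  fixes \<X> :: "real \<Rightarrow> real \<Rightarrow> 'd::finite forest \<Rightarrow> real"
    and Z :: "real \<Rightarrow> 'd forest \<Rightarrow> 'a::real_vector" and i :: 'd
  assumes X: "planarly_branched_rough_path \<alpha> N T \<X>" and "1 \<le> N"
    and st: "s \<in> {0..T}" "u \<in> {0..T}" "t \<in> {0..T}"
  defines "A \<equiv> \<lambda>s t. \<Sum>\<tau>\<in>forests_le (N - 1). \<X> s t [Node i \<tau>] *\<^sub>R Z s \<tau>"
  shows "A s t - A s u - A u t = - (\<Sum>b\<in>forests_le (N - 1). \<X> u t [Node i b] *\<^sub>R
    (Z u b - (\<Sum>\<sigma>\<in>forests_le (N - 1). (\<X> s u \<star> basis b) \<sigma> *\<^sub>R Z s \<sigma>)))"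
proof -
  \<comment> \<open>The cut with empty right side gives the first summand, which adds up to
    \<open>A s u\<close>. All other cuts keep the root on the right, so \<open>\<X> u t\<close> is
    only evaluated on trees with root \<open>i\<close>.\<close>
  have Chen: "\<X> s t [Node i \<tau>] = \<X> s u [Node i \<tau>] +
      (\<Sum>b\<in>forests_le (N - 1). (\<X> s u \<star> basis b) \<tau> * \<X> u t [Node i b])"
    if "\<tau> \<in> forests_le (N - 1)" for \<tau>
  proof -
    have "forest_size [Node i \<tau>] \<le> N"
      using that assms(2) by (auto simp: forests_le_def)
    from rough_path_Chen[OF X st this]
    have "\<X> s t [Node i \<tau>] = \<X> s u [Node i \<tau>] + (\<X> s u \<star> (\<lambda>b. \<X> u t [Node i b])) \<tau>"
      using rough_path_Nil[OF X st(2,3)] by (simp add: star_Node) (simp add: star_def)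
    then show ?thesis
      unfolding star_basis_expansion[OF that, of "\<X> s u" "\<lambda>b. \<X> u t [Node i b]"] .
  qed
  have "A s t = A s u + (\<Sum>\<tau>\<in>forests_le (N - 1). \<Sum>b\<in>forests_le (N - 1).
      ((\<X> s u \<star> basis b) \<tau> * \<X> u t [Node i b]) *\<^sub>R Z s \<tau>)"
    by (simp add: A_def Chen scaleR_add_left sum.distrib scaleR_sum_left)
  also have "(\<Sum>\<tau>\<in>forests_le (N - 1). \<Sum>b\<in>forests_le (N - 1).
      ((\<X> s u \<star> basis b) \<tau> * \<X> u t [Node i b]) *\<^sub>R Z s \<tau>) =
      (\<Sum>b\<in>forests_le (N - 1). \<X> u t [Node i b] *\<^sub>R
        (\<Sum>\<sigma>\<in>forests_le (N - 1). (\<X> s u \<star> basis b) \<sigma> *\<^sub>R Z s \<sigma>))"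
    by (subst sum.swap) (simp add: scaleR_right.sum mult.commute)
  finally show ?thesis
    by (simp add: A_def scaleR_right_diff_distrib sum_subtractf)
qed

text \<open>The remainder at \<open>b\<close> has order (N - |b|)\<alpha> and its coefficient order
  (|b| + 1)\<alpha>, so the exponents add up to (N + 1)\<alpha> for every \<open>b\<close>. The
  times are not ordered and \<open>m\<close> is any bound of both gaps, which makes the estimate
  available for \<open>(s, t, s)\<close> and, with \<open>m = 0\<close>, on the diagonal.\<close>

lemma local_approximation_almost_additive:
  fixes \<X> :: "real \<Rightarrow> real \<Rightarrow> 'd::finite forest \<Rightarrow> real"
    and Z :: "real \<Rightarrow> 'd forest \<Rightarrow> real ^ 'n" and i :: 'd
  assumes X: "planarly_branched_rough_path \<alpha> N T \<X>" and "1 \<le> N" "0 \<le> \<alpha>"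
    and Z: "controlled_path \<alpha> N T \<X> Z"
  defines "A \<equiv> \<lambda>s t. \<Sum>\<tau>\<in>forests_le (N - 1). \<X> s t [Node i \<tau>] *\<^sub>R Z s \<tau>"
  obtains K where "\<And>s u t m. s \<in> {0..T} \<Longrightarrow> u \<in> {0..T} \<Longrightarrow> t \<in> {0..T} \<Longrightarrow>
    \<bar>u - s\<bar> \<le> m \<Longrightarrow> \<bar>t - u\<bar> \<le> m \<Longrightarrow>
    norm (A s t - A s u - A u t) \<le> K * m powr ((real N + 1) * \<alpha>)"
proof -
  let ?r = "\<lambda>b s u. Z u b - (\<Sum>\<sigma>\<in>forests_le (N - 1). (\<X> s u \<star> basis b) \<sigma> *\<^sub>R Z s \<sigma>)"
  have "\<exists>K. \<forall>s u t m. s \<in> {0..T} \<longrightarrow> u \<in> {0..T} \<longrightarrow> t \<in> {0..T} \<longrightarrow>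
      \<bar>u - s\<bar> \<le> m \<longrightarrow> \<bar>t - u\<bar> \<le> m \<longrightarrow>
      norm (\<X> u t [Node i b] *\<^sub>R ?r b s u) \<le> K * m powr ((real N + 1) * \<alpha>)"
    if b: "b \<in> forests_le (N - 1)" for b
  proof -
    have size: "forest_size [Node i b] \<le> N"
      using b assms(2) by (auto simp: forests_le_def)
    obtain C1 where C1: "0 \<le> C1" "\<And>s t. s \<in> {0..T} \<Longrightarrow> t \<in> {0..T} \<Longrightarrow>
        norm (\<X> s t [Node i b]) \<le> C1 * \<bar>t - s\<bar> powr (real (forest_size [Node i b]) * \<alpha>)"
      by (rule hoelder_orderE[OF rough_path_order[OF X size]]) auto
    have "hoelder_order T ((real N - real (forest_size b)) * \<alpha>) (?r b)"
      using Z b by (simp add: controlled_path_iff)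
    then obtain C2 where C2: "0 \<le> C2" "\<And>s t. s \<in> {0..T} \<Longrightarrow> t \<in> {0..T} \<Longrightarrow>
        norm (?r b s t) \<le> C2 * \<bar>t - s\<bar> powr ((real N - real (forest_size b)) * \<alpha>)"
      by (rule hoelder_orderE) blast
    have "norm (\<X> u t [Node i b] *\<^sub>R ?r b s u) \<le> (C1 * C2) * m powr ((real N + 1) * \<alpha>)"
      if "s \<in> {0..T}" "u \<in> {0..T}" "t \<in> {0..T}" "\<bar>u - s\<bar> \<le> m" "\<bar>t - u\<bar> \<le> m" for s u t m
    proof -
      have "norm (\<X> u t [Node i b]) \<le> C1 * m powr (real (forest_size [Node i b]) * \<alpha>)"
        using that assms(3) C1(1)
        by (intro order_trans[OF C1(2)[OF that(2,3)]] mult_left_mono powr_mono2) auto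
      moreover have "norm (?r b s u) \<le> C2 * m powr ((real N - real (forest_size b)) * \<alpha>)"
        using that assms(3) C2(1) size
        by (intro order_trans[OF C2(2)[OF that(1,2)]] mult_left_mono powr_mono2) auto
      ultimately have "norm (\<X> u t [Node i b] *\<^sub>R ?r b s u) \<le>
          (C1 * m powr (real (forest_size [Node i b]) * \<alpha>)) *
          (C2 * m powr ((real N - real (forest_size b)) * \<alpha>))"
        unfolding norm_scaleR real_norm_def using C1(1) by (intro mult_mono) auto
      also have "\<dots> = (C1 * C2) * m powr (real (forest_size [Node i b]) * \<alpha> +
          (real N - real (forest_size b)) * \<alpha>)"
        by (simp add: powr_add)
      also have "real (forest_size [Node i b]) * \<alpha> + (real N - real (forest_size b)) * \<alpha> =
          (real N + 1) * \<alpha>"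
        by (simp add: algebra_simps)
      finally show ?thesis .
    qed
    then show ?thesis by blast
  qed
  then have "\<forall>b\<in>forests_le (N - 1). \<exists>K. \<forall>s u t m. s \<in> {0..T} \<longrightarrow> u \<in> {0..T} \<longrightarrow> t \<in> {0..T} \<longrightarrow>
      \<bar>u - s\<bar> \<le> m \<longrightarrow> \<bar>t - u\<bar> \<le> m \<longrightarrow>
      norm (\<X> u t [Node i b] *\<^sub>R ?r b s u) \<le> K * m powr ((real N + 1) * \<alpha>)" ..
  from bchoice[OF this] obtain K where K: "\<forall>b\<in>forests_le (N - 1). \<forall>s u t m.
      s \<in> {0..T} \<longrightarrow> u \<in> {0..T} \<longrightarrow> t \<in> {0..T} \<longrightarrow> \<bar>u - s\<bar> \<le> m \<longrightarrow> \<bar>t - u\<bar> \<le> m \<longrightarrow>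
      norm (\<X> u t [Node i b] *\<^sub>R ?r b s u) \<le> K b * m powr ((real N + 1) * \<alpha>)" ..
  show ?thesis
  proof (rule that)
    fix s u t m
    assume st: "s \<in> {0..T}" "u \<in> {0..T}" "t \<in> {0..T}" and m: "\<bar>u - s\<bar> \<le> m" "\<bar>t - u\<bar> \<le> m"
    have "norm (A s t - A s u - A u t) \<le> (\<Sum>b\<in>forests_le (N - 1). K b * m powr ((real N + 1) * \<alpha>))"
      unfolding A_def local_approximation_defect[OF X assms(2) st] norm_minus_cancel
      by (intro sum_norm_le K[rule_format] st m)
    then show "norm (A s t - A s u - A u t) \<le>
        (\<Sum>b\<in>forests_le (N - 1). K b) * m powr ((real N + 1) * \<alpha>)"
      by (simp add: sum_distrib_right)
  qed
qed

lemma rough_integral_increment: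
  fixes \<X> :: "real \<Rightarrow> real \<Rightarrow> 'd::finite forest \<Rightarrow> real"
    and Z :: "real \<Rightarrow> 'd forest \<Rightarrow> real ^ 'n" and i :: 'd
  assumes X: "planarly_branched_rough_path \<alpha> N T \<X>" and "1 \<le> N" "0 \<le> \<alpha>"
    and \<theta>: "1 < (real N + 1) * \<alpha>" and Z: "controlled_path \<alpha> N T \<X> Z"
  defines "A \<equiv> \<lambda>s t. \<Sum>\<tau>\<in>forests_le (N - 1). \<X> s t [Node i \<tau>] *\<^sub>R Z s \<tau>"
  obtains C where "\<And>s. s \<in> {0..T} \<Longrightarrow> A s s = 0" and
    "\<And>s t I J. s \<in> {0..T} \<Longrightarrow> t \<in> {0..T} \<Longrightarrow> s \<noteq> t \<Longrightarrow>
      has_rough_integral N \<X> Z i 0 s I \<Longrightarrow> has_rough_integral N \<X> Z i 0 t J \<Longrightarrow>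
      norm (J - I - A s t) \<le> C * \<bar>t - s\<bar> powr ((real N + 1) * \<alpha>)"
proof -
  let ?\<theta> = "(real N + 1) * \<alpha>"
  obtain K where K: "\<And>s u t m. s \<in> {0..T} \<Longrightarrow> u \<in> {0..T} \<Longrightarrow> t \<in> {0..T} \<Longrightarrow>
      \<bar>u - s\<bar> \<le> m \<Longrightarrow> \<bar>t - u\<bar> \<le> m \<Longrightarrow> norm (A s t - A s u - A u t) \<le> K * m powr ?\<theta>"
    unfolding A_def by (rule local_approximation_almost_additive[OF X assms(2,3) Z, of i]) blast
  \<comment> \<open>For \<open>s = u = t\<close> the defect is \<open>- A s s\<close>, and
    \<open>0 powr ?\<theta> = 0\<close>.\<close>
  have diag: "A s s = 0" if "s \<in> {0..T}" for s
    using K[OF that that that, of 0] by simp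
  have K0: "0 \<le> K * m powr ?\<theta>" if "s \<in> {0..T}" "0 \<le> m" for s m
    using K[OF that(1) that(1) that(1), of m] that(2) by (auto intro: order_trans[OF norm_ge_zero])
  define C where "C = K / (1 - 2 powr (1 - ?\<theta>))"
  have fwd: "norm (J - I - A s t) \<le> C * (t - s) powr ?\<theta>"
    if "0 \<le> s" "s < t" "t \<le> T" "has_rough_integral N \<X> Z i 0 s I" "has_rough_integral N \<X> Z i 0 t J"
    for s t I J
    unfolding C_def
  proof (rule sewing_increment[OF \<theta> that(1-3)])
    show "norm (A s t - A s u - A u t) \<le> K * (t - s) powr ?\<theta>"
      if "0 \<le> s" "s \<le> u" "u \<le> t" "t \<le> T" for s u t
      using that by (intro K) auto
  qed (use that in \<open>simp_all add: has_rough_integral_def A_def\<close>)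
  show ?thesis
  proof (rule that)
    fix s t I J
    assume st: "s \<in> {0..T}" "t \<in> {0..T}" "s \<noteq> t"
      and I: "has_rough_integral N \<X> Z i 0 s I" and J: "has_rough_integral N \<X> Z i 0 t J"
    \<comment> \<open>Forward in time \<open>C\<close> alone serves; backward in time the defect
      adds \<open>K\<close>. By \<open>K0\<close> one constant covers both cases.\<close>
    show "norm (J - I - A s t) \<le> (C + K) * \<bar>t - s\<bar> powr ?\<theta>"
    proof (cases "s < t")
      case True
      then show ?thesis
        using fwd[OF _ True _ I J] K0[OF st(1), of "t - s"] st by (simp add: distrib_right)
    next
      case False
      then have "t < s" using st by simp
      \<comment> \<open>As \<open>A s s = 0\<close>, the backward error is the defect of the triple
        \<open>(s, t, s)\<close> minus the forward error from \<open>t\<close> to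
        \<open>s\<close>.\<close>
      have "J - I - A s t = (A s s - A s t - A t s) - (I - J - A t s)"
        using diag[OF st(1)] by simp
      also have "norm \<dots> \<le> K * \<bar>t - s\<bar> powr ?\<theta> + C * (s - t) powr ?\<theta>"
        using st \<open>t < s\<close>
        by (intro order_trans[OF norm_triangle_ineq4] add_mono K fwd I J) auto
      finally show ?thesis using \<open>t < s\<close> by (simp add: algebra_simps)
    qed
  qed (rule diag)
qed

section \<open>Elementary differentials and the expansion of the solution\<close>

lemma elem_diff_Node: "elem_diff f (Node i \<tau>) u = D (f i) u (map (\<lambda>t. elem_diff f t u) \<tau>)"
  by (cases \<tau>) simp_all

text \<open>Since only factorizations into single trees survive, the equation for
  \<open>\<Y>\<close> on a tree becomes the recursion of \<open>elem_diff\<close>, and structural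
  induction applies.\<close>

lemma controlled_solution_elem_diff:
  fixes \<Y> :: "real \<Rightarrow> 'd::finite forest \<Rightarrow> real ^ 'n"
  assumes "2 \<le> N"
    and solution: "\<And>i \<tau>. \<tau> \<in> forests_le (N - 2) \<Longrightarrow>
      \<Y> t [Node i \<tau>] = compose_controlled N (f i) \<Y> t \<tau>"
    and zero: "\<And>\<sigma>. \<sigma> \<in> forests_le (N - 1) \<Longrightarrow> 2 \<le> length \<sigma> \<Longrightarrow> \<Y> t \<sigma> = 0"
    and "tree_size x \<le> N - 1"
  shows "\<Y> t [x] = elem_diff f x (\<Y> t [])"
  using assms(4)
proof (induction x)
  case (Node i \<tau>)
  \<comment> \<open>The root counts as a vertex, so the forest below it lies in the range
    \<open>N - 2\<close> of the solution equation.\<close>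
  then have \<tau>: "\<tau> \<in> forests_le (N - 2)" "\<tau> \<in> forests_le (N - 1)"
    by (auto simp: forests_le_def forest_size_def)
  have "tree_size x \<le> N - 1" if "x \<in> set \<tau>" for x
    using Node.prems member_le_sum_list[of "tree_size x" "map tree_size \<tau>"] that by simp
  then have "map (\<lambda>x. \<Y> t [x]) \<tau> = map (\<lambda>x. elem_diff f x (\<Y> t [])) \<tau>"
    using Node.IH by simp
  moreover have "\<Y> t [Node i \<tau>] = D (f i) (\<Y> t []) (map (\<lambda>x. \<Y> t [x]) \<tau>)"
    unfolding solution[OF \<tau>(1)] by (intro compose_controlled_eq_D \<tau>(2) zero)
  ultimately show ?case
    by (simp only: elem_diff_Node)
qed

text \<open>The bijection removes the root. For \<open>N = 0\<close> truncated subtraction would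
  leave the bullets on the right-hand side only.\<close>

lemma sum_trees_le:
  assumes "1 \<le> N"
  shows "(\<Sum>x\<in>trees_le N. F x) = (\<Sum>i\<in>(UNIV :: 'd::finite set). \<Sum>\<tau>\<in>forests_le (N - 1). F (Node i \<tau>))"
proof -
  have "bij_betw (\<lambda>(i, \<tau>). Node i \<tau>) (UNIV \<times> forests_le (N - 1)) (trees_le N :: 'd tree set)"
    using assms
    by (intro bij_betw_byWitness[where f' = "\<lambda>x. case x of Node i \<tau> \<Rightarrow> (i, \<tau>)"])
       (auto simp: trees_le_def forests_le_def forest_size_def split: tree.splits)
  from sum.reindex_bij_betw[OF this, of F] show ?thesis
    by (simp add: sum.cartesian_product case_prod_unfold)
qed

lemma powr_little_o:
  fixes C \<theta> \<epsilon> :: real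
  assumes "1 < \<theta>" "0 < \<epsilon>"
  obtains \<delta> where "0 < \<delta>" "\<And>h. 0 \<le> h \<Longrightarrow> h < \<delta> \<Longrightarrow> C * h powr \<theta> \<le> \<epsilon> * h"
proof
  \<comment> \<open>Below the threshold \<open>?d\<close> the power
    \<open>h powr (\<theta> - 1)\<close> is at most \<open>?q\<close>; the added 1 keeps the
    denominator positive when \<open>C = 0\<close>.\<close>
  let ?q = "\<epsilon> / (\<bar>C\<bar> + 1)"
  let ?d = "?q powr (1 / (\<theta> - 1))"
  have q: "0 < ?q" using assms(2) by simp
  then show "0 < ?d" unfolding powr_gt_zero by (rule less_imp_neq[THEN not_sym])
  show "C * h powr \<theta> \<le> \<epsilon> * h" if h: "0 \<le> h" "h < ?d" for h
  proof (cases "h = 0")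
    case False
    have "h powr (\<theta> - 1) \<le> ?d powr (\<theta> - 1)"
      using h assms(1) by (intro powr_mono2) auto
    also have "\<dots> = ?q powr 1" using assms(1) by (simp add: powr_powr)
    also have "\<dots> = ?q" using q by (intro powr_one) simp
    finally have "C * h powr (\<theta> - 1) \<le> \<bar>C\<bar> * ?q"
      by (intro mult_mono) auto
    also have "\<dots> \<le> \<epsilon>" using assms(2) by (simp add: field_simps)
    finally have "C * h powr (\<theta> - 1) * h \<le> \<epsilon> * h"
      using h(1) by (rule mult_right_mono)
    then show ?thesis
      using h(1) False powr_add[of h "\<theta> - 1" 1] by simp
  qed simp
qed

theorem proposition2p12:
  fixes \<alpha> T :: real and N :: nat
    and \<X> :: "real \<Rightarrow> real \<Rightarrow> 'd::finite forest \<Rightarrow> real"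
    and X :: "real \<Rightarrow> real ^ 'd"
    and f :: "'d \<Rightarrow> real ^ 'n \<Rightarrow> real ^ 'n"
    and \<xi> :: "real ^ 'n"
    and \<Y> :: "real \<Rightarrow> 'd forest \<Rightarrow> real ^ 'n"
    and Y :: "real \<Rightarrow> real ^ 'n"
  assumes "1 / 4 < \<alpha>" and "\<alpha> \<le> 1 / 2" and "N = nat \<lfloor>1 / \<alpha>\<rfloor>" and "0 \<le> T"
    and "planarly_branched_rough_path \<alpha> N T \<X>" and "rough_path_above T \<X> X"
    and "\<And>i. smooth (f i)"
    and "solves_rde \<alpha> N T \<X> f \<xi> \<Y>"
    and "\<And>t. t \<in> {0..T} \<Longrightarrow> \<Y> t [] = Y t"
  shows "\<forall>\<epsilon>>0. \<exists>\<delta>>0. \<forall>s\<in>{0..T}. \<forall>t\<in>{0..T}. \<bar>t - s\<bar> < \<delta> \<longrightarrow>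
    norm (Y t - Y s - (\<Sum>\<tau>\<in>trees_le N. \<X> s t [\<tau>] *\<^sub>R elem_diff f \<tau> (Y s))) \<le> \<epsilon> * \<bar>t - s\<bar>"
proof -
  note X = assms(5)
  let ?\<theta> = "(real N + 1) * \<alpha>"
  define Z where "Z i = compose_controlled N (f i) \<Y>" for i
  define A where "A i s t = (\<Sum>\<tau>\<in>forests_le (N - 1). \<X> s t [Node i \<tau>] *\<^sub>R Z i s \<tau>)" for i s t
  have floor: "\<lfloor>1 / \<alpha>\<rfloor> = 2 \<or> \<lfloor>1 / \<alpha>\<rfloor> = 3"
  proof -
    have "2 \<le> 1 / \<alpha>" "1 / \<alpha> < 4" using assms(1,2) by (auto simp: field_simps)
    then have "2 \<le> \<lfloor>1 / \<alpha>\<rfloor>" "\<lfloor>1 / \<alpha>\<rfloor> < 4" by linarith+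
    then show ?thesis by linarith
  qed
  then have N: "N = 2 \<or> N = 3" using assms(3) by auto
  then have N_ge: "1 \<le> N" "2 \<le> N" by auto
  \<comment> \<open>The floor of 1/\<alpha> is larger than 1/\<alpha> - 1, which yields (N +
    1)\<alpha> > 1, the exponent needed for sewing.\<close>
  have "real N = of_int \<lfloor>1 / \<alpha>\<rfloor>" using floor assms(3) by auto
  then have "1 / \<alpha> < real N + 1" by linarith
  moreover have "0 < \<alpha>" using assms(1) by simp
  ultimately have \<theta>: "1 < ?\<theta>" by (simp only: pos_divide_less_eq)
  note solves = assms(8)[unfolded solves_rde_def, folded Z_def]
  have ctrl: "controlled_path \<alpha> N T \<X> \<Y>"
    using solves by (rule conjunct1)
  have int: "\<forall>t\<in>{0..T}. \<exists>I. (\<forall>i. has_rough_integral N \<X> (Z i) i 0 t (I i)) \<and>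
        \<Y> t [] = \<xi> + (\<Sum>i\<in>UNIV. I i)"
    using solves[THEN conjunct2] by (rule conjunct1)
  have sol: "\<Y> t [Node i \<tau>] = Z i t \<tau>" if "t \<in> {0..T}" "\<tau> \<in> forests_le (N - 2)" for t i \<tau>
    using solves[THEN conjunct2, THEN conjunct2, THEN conjunct1] that by simp
  have zero: "\<Y> t \<tau> = 0" if "t \<in> {0..T}" "\<tau> \<in> forests_le (N - 1)" "2 \<le> length \<tau>" for t \<tau>
    using solves[THEN conjunct2, THEN conjunct2, THEN conjunct2] that by simp
  have Z: "controlled_path \<alpha> N T \<X> (Z i)" for i
    using N
  proof (elim disjE)
    assume "N = 2"
    then show ?thesis
      using compose_controlled_controlled_2[of \<alpha> T \<X> \<Y> "f i"] X ctrl assms(1,7) zero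
      by (simp add: Z_def)
  next
    assume "N = 3"
    then show ?thesis
      using compose_controlled_controlled_3[of \<alpha> T \<X> \<Y> "f i"] X ctrl assms(1,7) zero
      by (simp add: Z_def)
  qed
  have "\<exists>C. (\<forall>s\<in>{0..T}. A i s s = 0) \<and> (\<forall>s\<in>{0..T}. \<forall>t\<in>{0..T}. s \<noteq> t \<longrightarrow>
      (\<forall>I J. has_rough_integral N \<X> (Z i) i 0 s I \<longrightarrow> has_rough_integral N \<X> (Z i) i 0 t J \<longrightarrow>
        norm (J - I - A i s t) \<le> C * \<bar>t - s\<bar> powr ?\<theta>))" for i
  proof -
    obtain C where "\<And>s. s \<in> {0..T} \<Longrightarrow> A i s s = 0"
      "\<And>s t I J. s \<in> {0..T} \<Longrightarrow> t \<in> {0..T} \<Longrightarrow> s \<noteq> t \<Longrightarrow>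
      has_rough_integral N \<X> (Z i) i 0 s I \<Longrightarrow> has_rough_integral N \<X> (Z i) i 0 t J \<Longrightarrow>
      norm (J - I - A i s t) \<le> C * \<bar>t - s\<bar> powr ?\<theta>"
      unfolding A_def
      by (rule rough_integral_increment[OF X N_ge(1) less_imp_le[OF \<open>0 < \<alpha>\<close>] \<theta> Z[of i], of i]) blast
    then show ?thesis by blast
  qed
  then obtain C where diag: "\<And>i s. s \<in> {0..T} \<Longrightarrow> A i s s = 0" and
    C: "\<And>i s t I J. s \<in> {0..T} \<Longrightarrow> t \<in> {0..T} \<Longrightarrow> s \<noteq> t \<Longrightarrow>
      has_rough_integral N \<X> (Z i) i 0 s I \<Longrightarrow> has_rough_integral N \<X> (Z i) i 0 t J \<Longrightarrow>
      norm (J - I - A i s t) \<le> C i * \<bar>t - s\<bar> powr ?\<theta>"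
    by metis
  \<comment> \<open>Here \<open>\<tau>\<close> may have \<open>N - 1\<close> vertices, one more than
    the solution equation allows. The trees with \<open>N\<close> vertices are therefore reached
    through the composition formula for \<open>Z\<close>, while the identity for \<open>\<Y>\<close>
    is used only on the subtrees.\<close>
  have Z_elem: "Z i s \<tau> = elem_diff f (Node i \<tau>) (Y s)"
    if "s \<in> {0..T}" "\<tau> \<in> forests_le (N - 1)" for i s \<tau>
  proof -
    have "tree_size x \<le> N - 1" if "x \<in> set \<tau>" for x
      using \<open>\<tau> \<in> forests_le (N - 1)\<close> member_le_sum_list[of "tree_size x" "map tree_size \<tau>"] that
      by (simp add: forests_le_def forest_size_def)
    then have "map (\<lambda>x. \<Y> s [x]) \<tau> = map (\<lambda>x. elem_diff f x (\<Y> s [])) \<tau>"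
      using sol[unfolded Z_def] zero that(1)
      by (intro map_cong refl controlled_solution_elem_diff[OF N_ge(2)]) auto
    moreover have "Z i s \<tau> = D (f i) (\<Y> s []) (map (\<lambda>x. \<Y> s [x]) \<tau>)"
      unfolding Z_def by (intro compose_controlled_eq_D that(2) zero that(1))
    ultimately show ?thesis
      using assms(9)[OF that(1)] by (simp only: elem_diff_Node)
  qed
  have trees: "(\<Sum>\<tau>\<in>trees_le N. \<X> s t [\<tau>] *\<^sub>R elem_diff f \<tau> (Y s)) = (\<Sum>i\<in>UNIV. A i s t)"
    if "s \<in> {0..T}" for s t
    using that by (simp add: sum_trees_le[OF N_ge(1)] A_def Z_elem)
  have bound: "norm (Y t - Y s - (\<Sum>\<tau>\<in>trees_le N. \<X> s t [\<tau>] *\<^sub>R elem_diff f \<tau> (Y s)))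
      \<le> (\<Sum>i\<in>UNIV. C i) * \<bar>t - s\<bar> powr ?\<theta>" if st: "s \<in> {0..T}" "t \<in> {0..T}" for s t
  proof (cases "s = t")
    case True
    then show ?thesis using st by (simp add: trees diag)
  next
    case False
    \<comment> \<open>The integrals start at 0, so the increment of \<open>Y\<close> is the sum of
      the differences \<open>J i - I i\<close>, the quantity that \<open>C\<close> controls.\<close>
    obtain I J where I: "\<And>i. has_rough_integral N \<X> (Z i) i 0 s (I i)" "Y s = \<xi> + (\<Sum>i\<in>UNIV. I i)"
      and J: "\<And>i. has_rough_integral N \<X> (Z i) i 0 t (J i)" "Y t = \<xi> + (\<Sum>i\<in>UNIV. J i)"
      using bspec[OF int st(1)] bspec[OF int st(2)] assms(9)[OF st(1)] assms(9)[OF st(2)] by metis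
    have "Y t - Y s - (\<Sum>i\<in>UNIV. A i s t) = (\<Sum>i\<in>UNIV. J i - I i - A i s t)"
      by (simp add: I(2) J(2) sum_subtractf)
    also have "norm \<dots> \<le> (\<Sum>i\<in>UNIV. C i * \<bar>t - s\<bar> powr ?\<theta>)"
      by (intro sum_norm_le C st False I J)
    finally show ?thesis
      by (simp only: trees[OF st(1)] sum_distrib_right)
  qed
  show ?thesis
  proof (intro allI impI)
    fix \<epsilon> :: real
    assume "0 < \<epsilon>"
    then obtain \<delta> where \<delta>: "0 < \<delta>"
        "\<And>h. 0 \<le> h \<Longrightarrow> h < \<delta> \<Longrightarrow> (\<Sum>i\<in>UNIV. C i) * h powr ?\<theta> \<le> \<epsilon> * h"
      by (rule powr_little_o[OF \<theta>]) blast
    show "\<exists>\<delta>>0. \<forall>s\<in>{0..T}. \<forall>t\<in>{0..T}. \<bar>t - s\<bar> < \<delta> \<longrightarrow>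
        norm (Y t - Y s - (\<Sum>\<tau>\<in>trees_le N. \<X> s t [\<tau>] *\<^sub>R elem_diff f \<tau> (Y s))) \<le> \<epsilon> * \<bar>t - s\<bar>"
    proof (intro exI[of _ \<delta>] conjI ballI impI)
      fix s t assume "s \<in> {0..T}" "t \<in> {0..T}" "\<bar>t - s\<bar> < \<delta>"
      then show "norm (Y t - Y s - (\<Sum>\<tau>\<in>trees_le N. \<X> s t [\<tau>] *\<^sub>R elem_diff f \<tau> (Y s))) \<le> \<epsilon> * \<bar>t - s\<bar>"
        by (intro order_trans[OF bound \<delta>(2)]) simp_all
    qed (rule \<delta>(1))
  qed
qed

end
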